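(* Let $\varphi,\psi\colon\mathbb R_+\to\mathbb R_+$ be Borel functions. Let $A$ be a closed densely defined operator in a complex Hilbert space $\mathcal H$ and let $E$ be the spectral measure of $|A|$. Then the following conditions are equivalent: (i) $E(\psi^{-1}(\cdot))A\subseteq AE(\varphi^{-1}(\cdot))$; (ii) $\langle E(\varphi^{-1}(\cdot))|A|f,|A|f\rangle\leqslant\langle E(\psi^{-1}(\cdot))Af,Af\rangle$ for all $f\in\mathcal D(A)$.
   Context: All operators are linear and possibly unbounded; $\mathcal D(A)$ denotes the domain of $A$. $\mathbb R_+=[0,\infty)$ and $\mathfrak B(\mathbb R_+)$ is its Borel $\sigma$-algebra. For a closed densely defined $A$, $|A|$ is the square root of the positive selfadjoint operator $A^*A$, and its spectral measure is regarded as defined on $\mathfrak B(\mathbb R_+)$. $E(\varphi^{-1}(\cdot))$ stands for the spectral measure $\sigma\mapsto E(\varphi^{-1}(\sigma))$ on $\mathfrak B(\mathbb R_+)$, and similarly for $\psi$; relations involving $(\cdot)$ are understood to hold for every $\sigma\in\mathfrak B(\mathbb R_+)$ (the same $\sigma$ on both sides). $S\subseteq T$ means $\mathcal D(S)\subseteq\mathcal D(T)$ and $Sf=Tf$ for $f\in\mathcal D(S)$. *)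

theory Defs
  imports "HOL-Analysis.Analysis" "HOL-Library.Complex_Order"
begin

section \<open>Complex Hilbert spaces\<close>

text \<open>The inner product is linear in its first argument. The order on \<^typ>\<open>complex\<close> is that of
  \<^theory>\<open>HOL-Library.Complex_Order\<close>: \<open>z \<le> w\<close> means that \<open>w - z\<close> is a nonnegative real number.\<close>

class complex_hilbert = banach +
  fixes scaleC :: "complex \<Rightarrow> 'a \<Rightarrow> 'a"  (infixr \<open>*\<^sub>C\<close> 75)
    and cinner :: "'a \<Rightarrow> 'a \<Rightarrow> complex"
  assumes scaleR_eq_scaleC: "r *\<^sub>R x = complex_of_real r *\<^sub>C x"
    and scaleC_add_right: "a *\<^sub>C (x + y) = a *\<^sub>C x + a *\<^sub>C y"
    and scaleC_add_left: "(a + b) *\<^sub>C x = a *\<^sub>C x + b *\<^sub>C x"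
    and scaleC_scaleC: "a *\<^sub>C (b *\<^sub>C x) = (a * b) *\<^sub>C x"
    and cinner_add_left: "cinner (x + y) z = cinner x z + cinner y z"
    and cinner_scaleC_left: "cinner (a *\<^sub>C x) y = a * cinner x y"
    and cinner_commute: "cinner x y = cnj (cinner y x)"
    and cinner_nonneg: "0 \<le> cinner x x"
    and cinner_eq_zero_iff: "cinner x x = 0 \<longleftrightarrow> x = 0"
    and norm_eq_sqrt_cinner: "norm x = sqrt (Re (cinner x x))"

instantiation complex :: complex_hilbert
begin

definition scaleC_complex :: "complex \<Rightarrow> complex \<Rightarrow> complex" where
  "scaleC_complex a z = a * z"

definition cinner_complex :: "complex \<Rightarrow> complex \<Rightarrow> complex" where
  "cinner_complex z w = z * cnj w"

instance
proof
  fix x y z a b :: complex and r :: real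
  show "r *\<^sub>R x = complex_of_real r *\<^sub>C x"
    by (simp add: scaleC_complex_def scaleR_conv_of_real)
  show "a *\<^sub>C (x + y) = a *\<^sub>C x + a *\<^sub>C y" "(a + b) *\<^sub>C x = a *\<^sub>C x + b *\<^sub>C x"
    "a *\<^sub>C (b *\<^sub>C x) = (a * b) *\<^sub>C x"
    by (simp_all add: scaleC_complex_def algebra_simps)
  show "cinner (x + y) z = cinner x z + cinner y z" "cinner (a *\<^sub>C x) y = a * cinner x y"
    "cinner x y = cnj (cinner y x)" "cinner x x = 0 \<longleftrightarrow> x = 0"
    by (simp_all add: cinner_complex_def scaleC_complex_def algebra_simps)
  show "0 \<le> cinner x x"
    by (simp add: cinner_complex_def less_eq_complex_def)
  show "norm x = sqrt (Re (cinner x x))"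
    by (simp add: cinner_complex_def cmod_def power2_eq_square)
qed

end


section \<open>Unbounded operators\<close>

text \<open>An operator is a domain together with a map. Only the values of the map on the domain are
  meaningful, so operators are compared with \<open>\<subseteq>\<^sub>o\<close> and \<open>\<approx>\<^sub>o\<close>, not with \<open>=\<close>.\<close>

datatype 'a unbdd_op = Unbdd_Op (opdom: "'a set") (opapp: "'a \<Rightarrow> 'a")

definition op_le :: "'a unbdd_op \<Rightarrow> 'a unbdd_op \<Rightarrow> bool"  (infix \<open>\<subseteq>\<^sub>o\<close> 50) where
  "S \<subseteq>\<^sub>o T \<longleftrightarrow> opdom S \<subseteq> opdom T \<and> (\<forall>f\<in>opdom S. opapp S f = opapp T f)"

definition op_eq :: "'a unbdd_op \<Rightarrow> 'a unbdd_op \<Rightarrow> bool"  (infix \<open>\<approx>\<^sub>o\<close> 50) where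
  "S \<approx>\<^sub>o T \<longleftrightarrow> S \<subseteq>\<^sub>o T \<and> T \<subseteq>\<^sub>o S"

definition op_comp :: "'a unbdd_op \<Rightarrow> 'a unbdd_op \<Rightarrow> 'a unbdd_op"  (infixl \<open>\<circ>\<^sub>o\<close> 70) where
  "S \<circ>\<^sub>o T = Unbdd_Op {f \<in> opdom T. opapp T f \<in> opdom S} (\<lambda>f. opapp S (opapp T f))"

definition everywhere_defined :: "('a \<Rightarrow> 'a) \<Rightarrow> 'a unbdd_op" where
  "everywhere_defined P = Unbdd_Op UNIV P"

definition linear_op :: "'a::complex_hilbert unbdd_op \<Rightarrow> bool" where
  "linear_op T \<longleftrightarrow> 0 \<in> opdom T \<and>
    (\<forall>f\<in>opdom T. \<forall>g\<in>opdom T. f + g \<in> opdom T \<and> opapp T (f + g) = opapp T f + opapp T g) \<and>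
    (\<forall>a. \<forall>f\<in>opdom T. a *\<^sub>C f \<in> opdom T \<and> opapp T (a *\<^sub>C f) = a *\<^sub>C opapp T f)"

definition densely_defined :: "'a::complex_hilbert unbdd_op \<Rightarrow> bool" where
  "densely_defined T \<longleftrightarrow> closure (opdom T) = UNIV"

definition closed_op :: "'a::complex_hilbert unbdd_op \<Rightarrow> bool" where
  "closed_op T \<longleftrightarrow> closed ((\<lambda>f. (f, opapp T f)) ` opdom T)"

text \<open>The description in \<open>adjoint_op\<close> is unique whenever \<open>T\<close> is densely defined.\<close>

definition adjoint_op :: "'a::complex_hilbert unbdd_op \<Rightarrow> 'a unbdd_op" where
  "adjoint_op T = Unbdd_Op
    {g. \<exists>h. \<forall>f\<in>opdom T. cinner (opapp T f) g = cinner f h}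
    (\<lambda>g. THE h. \<forall>f\<in>opdom T. cinner (opapp T f) g = cinner f h)"

definition selfadjoint_op :: "'a::complex_hilbert unbdd_op \<Rightarrow> bool" where
  "selfadjoint_op T \<longleftrightarrow> linear_op T \<and> densely_defined T \<and> T \<approx>\<^sub>o adjoint_op T"

definition positive_op :: "'a::complex_hilbert unbdd_op \<Rightarrow> bool" where
  "positive_op T \<longleftrightarrow> (\<forall>f\<in>opdom T. 0 \<le> cinner (opapp T f) f)"

definition is_square_root :: "'a::complex_hilbert unbdd_op \<Rightarrow> 'a unbdd_op \<Rightarrow> bool" where
  "is_square_root R S \<longleftrightarrow> selfadjoint_op R \<and> positive_op R \<and> R \<circ>\<^sub>o R \<approx>\<^sub>o S"

text \<open>\<open>is_modulus A R\<close> says \<open>R = \<bar>A\<bar>\<close>; for closed densely defined \<open>A\<close> such an \<open>R\<close> exists and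
  is unique up to \<open>\<approx>\<^sub>o\<close>.\<close>

definition is_modulus :: "'a::complex_hilbert unbdd_op \<Rightarrow> 'a unbdd_op \<Rightarrow> bool" where
  "is_modulus A R \<longleftrightarrow> is_square_root R (adjoint_op A \<circ>\<^sub>o A)"


section \<open>Spectral measures and spectral integrals\<close>

definition orthogonal_projection :: "('a::complex_hilbert \<Rightarrow> 'a) \<Rightarrow> bool" where
  "orthogonal_projection P \<longleftrightarrow>
    (\<forall>f g. P (f + g) = P f + P g) \<and> (\<forall>a f. P (a *\<^sub>C f) = a *\<^sub>C P f) \<and>
    (\<forall>f. P (P f) = P f) \<and> (\<forall>f g. cinner (P f) g = cinner f (P g))"

text \<open>Only the underlying \<open>\<sigma>\<close>-algebra of \<open>M\<close> matters; countable additivity is in the strong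
  operator topology.\<close>

definition spectral_measure :: "'b measure \<Rightarrow> ('b set \<Rightarrow> 'a::complex_hilbert \<Rightarrow> 'a) \<Rightarrow> bool" where
  "spectral_measure M E \<longleftrightarrow>
    (\<forall>\<sigma>\<in>sets M. orthogonal_projection (E \<sigma>)) \<and>
    (\<forall>f. E (space M) f = f) \<and>
    (\<forall>S :: nat \<Rightarrow> 'b set. range S \<subseteq> sets M \<longrightarrow> disjoint_family S \<longrightarrow>
      (\<forall>f. (\<lambda>n. E (S n) f) sums E (\<Union>n. S n) f))"

text \<open>The finite positive measure \<open>\<sigma> \<mapsto> \<langle>E(\<sigma>)f, f\<rangle>\<close>.\<close>

definition scalar_measure ::
    "'b measure \<Rightarrow> ('b set \<Rightarrow> 'a::complex_hilbert \<Rightarrow> 'a) \<Rightarrow> 'a \<Rightarrow> 'b measure" where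
  "scalar_measure M E f =
    measure_of (space M) (sets M) (\<lambda>\<sigma>. ennreal (Re (cinner (E \<sigma> f) f)))"

definition simple_spectral_integral ::
    "'b measure \<Rightarrow> ('b set \<Rightarrow> 'a::complex_hilbert \<Rightarrow> 'a) \<Rightarrow> ('b \<Rightarrow> complex) \<Rightarrow> 'a \<Rightarrow> 'a" where
  "simple_spectral_integral M E s f =
    (\<Sum>y\<in>s ` space M. y *\<^sub>C E (s -` {y} \<inter> space M) f)"

text \<open>\<open>\<integral> h dE\<close> for measurable \<open>h\<close>: its domain consists of the \<open>f\<close> with
  \<open>\<integral> \<bar>h\<bar>\<^sup>2 d\<langle>E(\<cdot>)f, f\<rangle> < \<infinity>\<close>, and on such \<open>f\<close> it is the continuous extension to
  \<open>L\<^sup>2(\<langle>E(\<cdot>)f, f\<rangle>)\<close> of the isometry that maps a simple function \<open>s\<close> to \<open>(\<integral> s dE) f\<close>.\<close>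

definition spectral_integral ::
    "'b measure \<Rightarrow> ('b set \<Rightarrow> 'a::complex_hilbert \<Rightarrow> 'a) \<Rightarrow> ('b \<Rightarrow> complex) \<Rightarrow> 'a unbdd_op" where
  "spectral_integral M E h = Unbdd_Op
    {f. (\<integral>\<^sup>+ x. ennreal ((cmod (h x))\<^sup>2) \<partial>scalar_measure M E f) < \<infinity>}
    (\<lambda>f. THE g. \<forall>s :: nat \<Rightarrow> 'b \<Rightarrow> complex.
      (\<forall>n. simple_function M (s n)) \<longrightarrow>
      (\<lambda>n. \<integral>\<^sup>+ x. ennreal ((cmod (s n x - h x))\<^sup>2) \<partial>scalar_measure M E f) \<longlonglongrightarrow> 0 \<longrightarrow>
      (\<lambda>n. simple_spectral_integral M E (s n) f) \<longlonglongrightarrow> g)"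

text \<open>The Borel space of the half-line \<open>[0, \<infinity>)\<close>.\<close>

abbreviation borel_Rplus :: "real measure" where
  "borel_Rplus \<equiv> restrict_space borel {0..}"

definition is_spectral_measure_of ::
    "(real set \<Rightarrow> 'a::complex_hilbert \<Rightarrow> 'a) \<Rightarrow> 'a unbdd_op \<Rightarrow> bool" where
  "is_spectral_measure_of E T \<longleftrightarrow>
    spectral_measure borel_Rplus E \<and> T \<approx>\<^sub>o spectral_integral borel_Rplus E complex_of_real"

end

theory Submission
  imports Defs
begin

text \<open>The domain of \<open>A\<^sup>*A\<close> is a core for \<open>A\<close> and for \<open>\<bar>A\<bar>\<close>, and \<open>\<parallel>A f\<parallel> = \<parallel>\<bar>A\<bar> f\<parallel>\<close> on it, so the two
  operators have the same domain and the same norms. Write \<open>P = E(\<phi>\<^sup>-\<^sup>1(\<sigma>))\<close> and \<open>Q = E(\<psi>\<^sup>-\<^sup>1(\<sigma>))\<close>.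
  As \<open>P\<close> commutes with \<open>\<bar>A\<bar>\<close>, the inequality (ii) says \<open>\<parallel>A P f\<parallel> \<le> \<parallel>Q A f\<parallel>\<close>. Adding (ii) for \<open>\<sigma>\<close> and for
  its complement gives \<open>\<parallel>A f\<parallel>\<^sup>2\<close> on both sides, so (ii) forces \<open>\<parallel>A P f\<parallel> = \<parallel>Q A f\<parallel>\<close> and
  \<open>\<parallel>A (f - P f)\<parallel> = \<parallel>A f - Q A f\<parallel>\<close>. The second equality at \<open>P f\<close> gives \<open>Q A P f = A P f\<close>, the first at
  \<open>f - P f\<close> gives \<open>Q A (f - P f) = 0\<close>; together \<open>Q A f = A P f\<close>, which is (i).\<close>

section \<open>Geometry of complex Hilbert spaces\<close>

lemma scaleC_zero_left [simp]: "0 *\<^sub>C (x::'a::complex_hilbert) = 0"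
  using scaleR_eq_scaleC[of 0 x] by simp

lemma scaleC_minus_one: "(-1) *\<^sub>C (x::'a::complex_hilbert) = - x"
  using scaleR_eq_scaleC[of "-1" x] by simp

lemma cinner_zero_left [simp]: "cinner 0 (x::'a::complex_hilbert) = 0"
  using cinner_scaleC_left[of 0 x x] by simp

lemma cinner_minus_left: "cinner (- x) (y::'a::complex_hilbert) = - cinner x y"
  using cinner_scaleC_left[of "-1" x y] by (simp add: scaleC_minus_one)

lemma cinner_diff_left: "cinner (x - y) (z::'a::complex_hilbert) = cinner x z - cinner y z"
  using cinner_add_left[of x "- y" z] by (simp add: cinner_minus_left)

lemma cinner_add_right: "cinner x (y + z) = cinner x y + cinner x (z::'a::complex_hilbert)"
  by (subst (1 2 3) cinner_commute) (simp add: cinner_add_left)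

lemma cinner_scaleC_right: "cinner x (a *\<^sub>C y) = cnj a * cinner x (y::'a::complex_hilbert)"
  by (subst (1 2) cinner_commute) (simp add: cinner_scaleC_left)

lemma cinner_zero_right [simp]: "cinner (x::'a::complex_hilbert) 0 = 0"
  using cinner_scaleC_right[of x 0 x] by simp

lemma cinner_minus_right: "cinner x (- y) = - cinner x (y::'a::complex_hilbert)"
  using cinner_scaleC_right[of x "-1" y] by (simp add: scaleC_minus_one)

lemma cinner_diff_right: "cinner x (y - z) = cinner x y - cinner x (z::'a::complex_hilbert)"
  using cinner_add_right[of x y "- z"] by (simp add: cinner_minus_right)

lemma scaleC_diff_right: "a *\<^sub>C (x - y) = a *\<^sub>C x - a *\<^sub>C (y::'a::complex_hilbert)"
  using scaleC_add_right[of a "x - y" y] by simp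

lemma scaleC_zero_right [simp]: "a *\<^sub>C (0::'a::complex_hilbert) = 0"
  using scaleC_diff_right[of a 0 0] by simp

lemma scaleC_diff_left: "(a - b) *\<^sub>C x = a *\<^sub>C x - b *\<^sub>C (x::'a::complex_hilbert)"
  using scaleC_add_left[of "a - b" b x] by simp

lemma scaleC_sum_right:
  "a *\<^sub>C (\<Sum>i\<in>I. f i) = (\<Sum>i\<in>I. a *\<^sub>C (f i :: 'a::complex_hilbert))"
  by (induction I rule: infinite_finite_induct) (simp_all add: scaleC_add_right)

section \<open>Norm identities, Cauchy-Schwarz and continuity\<close>

lemma cinner_self: "cinner x x = complex_of_real ((norm (x::'a::complex_hilbert))\<^sup>2)"
  using cinner_nonneg[of x] norm_eq_sqrt_cinner[of x]
  by (auto simp: less_eq_complex_def complex_eq_iff)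

text \<open>Pythagoras: the subtracted multiple of \<open>z\<close> is the orthogonal projection of
  \<open>w\<close> onto the line through \<open>z\<close>. Cauchy-Schwarz and the orthogonality
  criterion for nearest points both follow from this identity.\<close>

lemma norm_diff_scaleC_squared:
  fixes w z :: "'a::complex_hilbert"
  assumes "z \<noteq> 0"
  shows "(norm (w - (cinner w z / cinner z z) *\<^sub>C z))\<^sup>2
    = (norm w)\<^sup>2 - (cmod (cinner w z))\<^sup>2 / (norm z)\<^sup>2"
proof -
  let ?t = "cinner w z / cinner z z"
  have nz: "cinner z z \<noteq> 0"
    using assms by (simp add: cinner_eq_zero_iff)
  \<comment> \<open>The choice of \<open>?t\<close> makes \<open>w - ?t *\<^sub>C z\<close>
    orthogonal to \<open>z\<close>, so only \<open>w\<close> survives in the second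
    argument.\<close>
  have "cinner (w - ?t *\<^sub>C z) (w - ?t *\<^sub>C z) = cinner (w - ?t *\<^sub>C z) w"
    using nz by (simp add: cinner_diff_left cinner_diff_right cinner_scaleC_left cinner_scaleC_right)
  also have "\<dots> = cinner w w - cinner w z * cnj (cinner w z) / cinner z z"
    by (simp add: cinner_diff_left cinner_scaleC_left cinner_commute[of z w])
  finally have "complex_of_real ((norm (w - ?t *\<^sub>C z))\<^sup>2)
    = complex_of_real ((norm w)\<^sup>2 - (cmod (cinner w z))\<^sup>2 / (norm z)\<^sup>2)"
    by (simp add: cinner_self complex_norm_square[symmetric])
  then show ?thesis
    by (simp only: of_real_eq_iff)
qed

lemma norm_cinner_le: "cmod (cinner x y) \<le> norm x * norm (y::'a::complex_hilbert)"
proof (cases "y = 0")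
  case False
  have "0 \<le> (norm x)\<^sup>2 - (cmod (cinner x y))\<^sup>2 / (norm y)\<^sup>2"
    unfolding norm_diff_scaleC_squared[OF False, of x, symmetric] by simp
  then have "(cmod (cinner x y))\<^sup>2 \<le> (norm x * norm y)\<^sup>2"
    using False by (simp add: field_simps power_mult_distrib)
  then show ?thesis
    by (rule power2_le_imp_le) simp
qed simp

text \<open>A complex sesquilinear form is bilinear over the reals, and Cauchy-Schwarz supplies the
  bound 1. This yields joint continuity of the inner product.\<close>

lemma bounded_bilinear_cinner: "bounded_bilinear (cinner :: 'a::complex_hilbert \<Rightarrow> 'a \<Rightarrow> complex)"
proof
  show "\<exists>K. \<forall>a b :: 'a. cmod (cinner a b) \<le> norm a * norm b * K"
    by (intro exI[of _ 1]) (simp add: norm_cinner_le)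
qed (simp_all add: cinner_add_left cinner_add_right scaleR_eq_scaleC cinner_scaleC_left
    cinner_scaleC_right scaleC_complex_def)

lemmas tendsto_cinner = bounded_bilinear.tendsto[OF bounded_bilinear_cinner]

lemma norm_scaleC: "norm (a *\<^sub>C x) = cmod a * norm (x::'a::complex_hilbert)"
proof -
  have "cinner (a *\<^sub>C x) (a *\<^sub>C x) = complex_of_real ((cmod a)\<^sup>2) * cinner x x"
    unfolding complex_norm_square by (simp add: cinner_scaleC_left cinner_scaleC_right)
  then have "complex_of_real ((norm (a *\<^sub>C x))\<^sup>2) = complex_of_real ((cmod a * norm x)\<^sup>2)"
    by (simp add: cinner_self power_mult_distrib)
  then have "(norm (a *\<^sub>C x))\<^sup>2 = (cmod a * norm x)\<^sup>2"
    by (simp only: of_real_eq_iff)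
  then show ?thesis
    by (simp only: power2_eq_iff_nonneg norm_ge_zero mult_nonneg_nonneg)
qed

lemma bounded_linear_scaleC: "bounded_linear (\<lambda>x::'a::complex_hilbert. a *\<^sub>C x)"
proof (rule bounded_linear_intro[where K = "cmod a"])
  fix r and x :: 'a
  show "a *\<^sub>C (r *\<^sub>R x) = r *\<^sub>R (a *\<^sub>C x)"
    by (simp add: scaleR_eq_scaleC scaleC_scaleC mult.commute)
qed (simp_all add: scaleC_add_right norm_scaleC mult.commute)

lemmas tendsto_scaleC = bounded_linear.tendsto[OF bounded_linear_scaleC]

lemma norm_add_squared:
  "(norm (x + y))\<^sup>2 = (norm x)\<^sup>2 + (norm y)\<^sup>2 + 2 * Re (cinner x (y::'a::complex_hilbert))"
proof -
  have "complex_of_real ((norm (x + y))\<^sup>2)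
      = complex_of_real ((norm x)\<^sup>2) + complex_of_real ((norm y)\<^sup>2) + (cinner x y + cnj (cinner x y))"
    unfolding cinner_self[symmetric]
    by (simp add: cinner_add_left cinner_add_right cinner_commute[of y x])
  then have "Re (complex_of_real ((norm (x + y))\<^sup>2))
      = Re (complex_of_real ((norm x)\<^sup>2) + complex_of_real ((norm y)\<^sup>2) + (cinner x y + cnj (cinner x y)))"
    by (rule arg_cong)
  then show ?thesis
    by (simp only: plus_complex.sel Re_complex_of_real complex_cnj) simp
qed

lemma parallelogram_law:
  "(norm (x + y))\<^sup>2 + (norm (x - y))\<^sup>2 = 2 * (norm x)\<^sup>2 + 2 * (norm (y::'a::complex_hilbert))\<^sup>2"
  using norm_add_squared[of x y] norm_add_squared[of x "- y"] by (simp add: cinner_minus_right)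

section \<open>Subspaces and the projection theorem\<close>

definition csubspace :: "'a::complex_hilbert set \<Rightarrow> bool" where
  "csubspace S \<longleftrightarrow> 0 \<in> S \<and> (\<forall>x\<in>S. \<forall>y\<in>S. x + y \<in> S) \<and> (\<forall>a. \<forall>x\<in>S. a *\<^sub>C x \<in> S)"

lemma csubspace_diff: "csubspace S \<Longrightarrow> x \<in> S \<Longrightarrow> y \<in> S \<Longrightarrow> x - y \<in> S"
  unfolding csubspace_def by (metis add_uminus_conv_diff scaleC_minus_one)

lemma csubspace_closure:
  assumes "csubspace S"
  shows "csubspace (closure S)"
  unfolding csubspace_def
proof (intro conjI ballI allI)
  show "0 \<in> closure S"
    using assms closure_subset by (auto simp: csubspace_def)
next
  fix x y assume "x \<in> closure S" "y \<in> closure S"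
  then obtain u v where "\<forall>n. u n \<in> S" "u \<longlonglongrightarrow> x" "\<forall>n. v n \<in> S" "v \<longlonglongrightarrow> y"
    unfolding closure_sequential by blast
  with assms show "x + y \<in> closure S"
    unfolding closure_sequential csubspace_def
    by (intro exI[of _ "\<lambda>n. u n + v n"]) (auto intro: tendsto_add)
next
  fix a x assume "x \<in> closure S"
  then obtain u where "\<forall>n. u n \<in> S" "u \<longlonglongrightarrow> x"
    unfolding closure_sequential by blast
  with assms show "a *\<^sub>C x \<in> closure S"
    unfolding closure_sequential csubspace_def
    by (intro exI[of _ "\<lambda>n. a *\<^sub>C u n"]) (auto intro: tendsto_scaleC)
qed

text \<open>If \<open>cinner w z\<close> were nonzero, subtracting the projection of
  \<open>w\<close> onto the line of \<open>z\<close> would strictly shorten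
  \<open>w\<close>.\<close>

lemma cinner_eq_zero_if_nearest:
  fixes w :: "'a::complex_hilbert"
  assumes "\<And>t. norm w \<le> norm (w - t *\<^sub>C z)"
  shows "cinner w z = 0"
proof (cases "z = 0")
  case False
  have "(norm w)\<^sup>2 \<le> (norm w)\<^sup>2 - (cmod (cinner w z))\<^sup>2 / (norm z)\<^sup>2"
    unfolding norm_diff_scaleC_squared[OF False, symmetric]
    by (intro power_mono assms) simp
  then have "(cmod (cinner w z))\<^sup>2 / (norm z)\<^sup>2 \<le> 0"
    by simp
  with False show ?thesis
    by (simp add: divide_le_0_iff power2_eq_square mult_le_0_iff)
qed simp

text \<open>A sequence in \<open>S\<close> minimizing the distance to \<open>x\<close> is Cauchy by
  the parallelogram law. Its limit is a nearest point of \<open>S\<close>, and nearest points have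
  orthogonal differences.\<close>

theorem orthogonal_decomposition:
  fixes S :: "'a::complex_hilbert set"
  assumes S: "csubspace S" "closed S"
  obtains y where "y \<in> S" "\<And>z. z \<in> S \<Longrightarrow> cinner (x - y) z = 0"
proof -
  define D where "D = (\<lambda>y. (norm (x - y))\<^sup>2) ` S"
  define d where "d = Inf D"
  have ne: "D \<noteq> {}" using S by (auto simp: D_def csubspace_def)
  have bdd: "bdd_below D" by (auto simp: D_def intro!: bdd_belowI[of _ 0])
  have d_le: "d \<le> (norm (x - y))\<^sup>2" if "y \<in> S" for y
    unfolding d_def using that by (intro cInf_lower bdd) (auto simp: D_def)
  have "\<exists>y\<in>S. (norm (x - y))\<^sup>2 < d + inverse (Suc n)" for n
    using cInf_lessD[OF ne, of "d + inverse (Suc n)"]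
    by (auto simp: d_def[symmetric]) (auto simp: D_def)
  then obtain u where uS: "\<And>n. u n \<in> S" and u: "\<And>n. (norm (x - u n))\<^sup>2 < d + inverse (Suc n)"
    by metis
  \<comment> \<open>The midpoint of \<open>u m\<close> and \<open>u n\<close> lies in
    \<open>S\<close>, so its squared distance to \<open>x\<close> is at least \<open>d\<close>. The
    parallelogram law then leaves only the two excesses over \<open>d\<close>, each doubled.\<close>
  have est: "(norm (u m - u n))\<^sup>2 \<le> 2 * inverse (Suc m) + 2 * inverse (Suc n)" for m n
  proof -
    have "(1/2) *\<^sub>R (u m + u n) \<in> S"
      using S uS by (simp add: csubspace_def scaleR_eq_scaleC)
    from d_le[OF this] have "4 * d \<le> (norm (2 *\<^sub>R (x - (1/2) *\<^sub>R (u m + u n))))\<^sup>2"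
      by (simp only: norm_scaleR power_mult_distrib) simp
    also have "2 *\<^sub>R (x - (1/2) *\<^sub>R (u m + u n)) = (x - u n) + (x - u m)"
      by (simp add: algebra_simps scaleR_2)
    finally have "4 * d \<le> (norm ((x - u n) + (x - u m)))\<^sup>2" .
    then show ?thesis
      using parallelogram_law[of "x - u n" "x - u m"] u[of n] u[of m] by simp
  qed
  have "Cauchy u"
  proof (rule metric_CauchyI)
    fix e :: real assume e: "0 < e"
    \<comment> \<open>The bound in \<open>est\<close> amounts to at most four times
      \<open>inverse (Suc N)\<close>.\<close>
    then obtain N where N: "inverse (Suc N) < e\<^sup>2 / 4"
      using reals_Archimedean[of "e\<^sup>2 / 4"] by auto
    have "dist (u m) (u n) < e" if "m \<ge> N" "n \<ge> N" for m n
    proof -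
      have "inverse (Suc m) \<le> inverse (Suc N)" "inverse (Suc n) \<le> inverse (Suc N)"
        using that by (simp_all add: field_simps)
      then have "(norm (u m - u n))\<^sup>2 < e\<^sup>2"
        using est[of m n] N by linarith
      then show ?thesis
        using e by (simp add: dist_norm power2_less_imp_less)
    qed
    then show "\<exists>M. \<forall>m\<ge>M. \<forall>n\<ge>M. dist (u m) (u n) < e"
      by blast
  qed
  then obtain y where y: "u \<longlonglongrightarrow> y"
    using convergent_eq_Cauchy by blast
  have yS: "y \<in> S"
    using S(2) uS y closed_sequentially by blast
  have d_ge: "(norm (x - y))\<^sup>2 \<le> d"
  proof (rule LIMSEQ_le)
    show "(\<lambda>n. (norm (x - u n))\<^sup>2) \<longlonglongrightarrow> (norm (x - y))\<^sup>2"
      by (intro tendsto_intros y)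
    show "(\<lambda>n. d + inverse (Suc n)) \<longlonglongrightarrow> d"
      using tendsto_add[OF tendsto_const LIMSEQ_inverse_real_of_nat, of d] by simp
  qed (use u in \<open>auto intro: less_imp_le\<close>)
  have nearest: "norm (x - y) \<le> norm (x - v)" if "v \<in> S" for v
    using order_trans[OF d_ge d_le[OF that]] by (rule power2_le_imp_le) simp
  have "cinner (x - y) z = 0" if "z \<in> S" for z
  proof (intro cinner_eq_zero_if_nearest)
    fix t
    have "y + t *\<^sub>C z \<in> S"
      using S that yS by (simp add: csubspace_def)
    then show "norm (x - y) \<le> norm (x - y - t *\<^sub>C z)"
      using nearest by (metis diff_diff_eq)
  qed
  with yS that show thesis by blast
qed

text \<open>With the sum of the inner products, graphs of operators become subspaces of a Hilbert
  space, and the projection theorem applies to them. The product norm is already the matching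
  Euclidean one.\<close>

instantiation prod :: (complex_hilbert, complex_hilbert) complex_hilbert
begin

definition scaleC_prod :: "complex \<Rightarrow> 'a \<times> 'b \<Rightarrow> 'a \<times> 'b" where
  "scaleC_prod a p = (a *\<^sub>C fst p, a *\<^sub>C snd p)"

definition cinner_prod :: "'a \<times> 'b \<Rightarrow> 'a \<times> 'b \<Rightarrow> complex" where
  "cinner_prod p q = cinner (fst p) (fst q) + cinner (snd p) (snd q)"

instance
proof
  fix x y z :: "'a \<times> 'b" and a b :: complex and r :: real
  show "r *\<^sub>R x = complex_of_real r *\<^sub>C x"
    by (simp add: scaleC_prod_def scaleR_prod_def scaleR_eq_scaleC)
  show "a *\<^sub>C (x + y) = a *\<^sub>C x + a *\<^sub>C y" "(a + b) *\<^sub>C x = a *\<^sub>C x + b *\<^sub>C x"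
    "a *\<^sub>C (b *\<^sub>C x) = (a * b) *\<^sub>C x"
    by (simp_all add: scaleC_prod_def scaleC_add_right scaleC_add_left scaleC_scaleC)
  show "cinner (x + y) z = cinner x z + cinner y z" "cinner (a *\<^sub>C x) y = a * cinner x y"
    by (simp_all add: cinner_prod_def scaleC_prod_def cinner_add_left cinner_scaleC_left algebra_simps)
  show "cinner x y = cnj (cinner y x)"
    unfolding cinner_prod_def by (subst (1 2) cinner_commute) simp
  have self: "cinner x x = complex_of_real ((norm (fst x))\<^sup>2 + (norm (snd x))\<^sup>2)"
    by (simp add: cinner_prod_def cinner_self)
  show "0 \<le> cinner x x"
    unfolding self by (simp add: less_eq_complex_def)
  show "cinner x x = 0 \<longleftrightarrow> x = 0"
    unfolding self of_real_eq_0_iff by (simp add: sum_power2_eq_zero_iff prod_eq_iff)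
  show "norm x = sqrt (Re (cinner x x))"
    unfolding self by (simp add: norm_prod_def)
qed

end

section \<open>The domain of \<open>T\<^sup>*T\<close> is a core\<close>

abbreviation graph :: "'a unbdd_op \<Rightarrow> ('a \<times> 'a) set" where
  "graph T \<equiv> (\<lambda>f. (f, opapp T f)) ` opdom T"

lemma op_eqD:
  assumes "S \<approx>\<^sub>o T"
  shows "opdom S = opdom T" "f \<in> opdom S \<Longrightarrow> opapp S f = opapp T f"
  using assms by (auto simp: op_eq_def op_le_def)

lemma op_eq_sym: "S \<approx>\<^sub>o T \<Longrightarrow> T \<approx>\<^sub>o S"
  by (simp add: op_eq_def)

lemma op_eq_trans: "S \<approx>\<^sub>o T \<Longrightarrow> T \<approx>\<^sub>o U \<Longrightarrow> S \<approx>\<^sub>o U"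
  unfolding op_eq_def op_le_def by force

lemma op_comp_cong_left:
  assumes "S \<approx>\<^sub>o T"
  shows "S \<circ>\<^sub>o U \<approx>\<^sub>o T \<circ>\<^sub>o U"
  using op_eqD[OF assms] unfolding op_eq_def op_le_def op_comp_def by force

lemma linear_op_add:
  "linear_op T \<Longrightarrow> f \<in> opdom T \<Longrightarrow> g \<in> opdom T \<Longrightarrow>
    f + g \<in> opdom T \<and> opapp T (f + g) = opapp T f + opapp T g"
  unfolding linear_op_def by blast

lemma linear_op_scaleC:
  "linear_op T \<Longrightarrow> f \<in> opdom T \<Longrightarrow> a *\<^sub>C f \<in> opdom T \<and> opapp T (a *\<^sub>C f) = a *\<^sub>C opapp T f"
  unfolding linear_op_def by blast

lemma linear_op_zero: "linear_op T \<Longrightarrow> 0 \<in> opdom T \<and> opapp T 0 = 0"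
  using linear_op_scaleC[of T 0 0] unfolding linear_op_def by simp

lemma linear_op_diff:
  assumes "linear_op T" "f \<in> opdom T" "g \<in> opdom T"
  shows "f - g \<in> opdom T \<and> opapp T (f - g) = opapp T f - opapp T g"
  using linear_op_add[OF assms(1), of f "(-1) *\<^sub>C g"] linear_op_scaleC[OF assms(1,3), of "-1"] assms(2)
  by (simp add: scaleC_minus_one)

text \<open>Used with \<open>D\<close> the whole domain and with \<open>D\<close> the domain of
  \<open>T\<^sup>*T\<close>, the candidate core.\<close>

lemma csubspace_graph:
  assumes "linear_op T" "csubspace D" "D \<subseteq> opdom T"
  shows "csubspace ((\<lambda>f. (f, opapp T f)) ` D)"
  unfolding csubspace_def
proof (intro conjI ballI allI)
  show "0 \<in> (\<lambda>f. (f, opapp T f)) ` D"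
    using assms linear_op_zero[OF assms(1)] by (auto simp: csubspace_def zero_prod_def image_iff)
next
  fix x y assume "x \<in> (\<lambda>f. (f, opapp T f)) ` D" "y \<in> (\<lambda>f. (f, opapp T f)) ` D"
  then obtain f g where "f \<in> D" "g \<in> D" and x: "x = (f, opapp T f)" and y: "y = (g, opapp T g)"
    by blast
  then have "f + g \<in> D" "x + y = (f + g, opapp T (f + g))"
    using assms(2) linear_op_add[OF assms(1), of f g] subsetD[OF assms(3)] by (simp_all add: csubspace_def)
  then show "x + y \<in> (\<lambda>f. (f, opapp T f)) ` D"
    by blast
next
  fix a x assume "x \<in> (\<lambda>f. (f, opapp T f)) ` D"
  then obtain f where "f \<in> D" and x: "x = (f, opapp T f)"
    by blast
  then have "a *\<^sub>C f \<in> D" "a *\<^sub>C x = (a *\<^sub>C f, opapp T (a *\<^sub>C f))"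
    using assms(2) linear_op_scaleC[OF assms(1), of f a] subsetD[OF assms(3)]
    by (simp_all add: csubspace_def scaleC_prod_def)
  then show "a *\<^sub>C x \<in> (\<lambda>f. (f, opapp T f)) ` D"
    by blast
qed

lemma csubspace_opdom: "linear_op T \<Longrightarrow> csubspace (opdom T)"
  unfolding linear_op_def csubspace_def by blast

lemma closed_opD:
  assumes "closed_op T" "\<And>n. u n \<in> opdom T" "u \<longlonglongrightarrow> x" "(\<lambda>n. opapp T (u n)) \<longlonglongrightarrow> y"
  shows "x \<in> opdom T" "opapp T x = y"
proof -
  have "(\<lambda>n. (u n, opapp T (u n))) \<longlonglongrightarrow> (x, y)"
    by (intro tendsto_Pair assms)
  then have "(x, y) \<in> graph T"
    using assms(1,2) closed_sequentially[of "graph T" "\<lambda>n. (u n, opapp T (u n))" "(x, y)"]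
    unfolding closed_op_def by blast
  then show "x \<in> opdom T" "opapp T x = y"
    by auto
qed

section \<open>Adjoints of densely defined operators\<close>

lemma orthogonal_to_dense:
  assumes "densely_defined T" "\<And>f. f \<in> opdom T \<Longrightarrow> cinner f h = 0"
  shows "h = 0"
proof -
  have "h \<in> closure (opdom T)"
    using assms(1) by (simp add: densely_defined_def)
  then obtain u where u: "\<And>n. u n \<in> opdom T" "u \<longlonglongrightarrow> h"
    unfolding closure_sequential by blast
  have "(\<lambda>n. cinner (u n) h) \<longlonglongrightarrow> cinner h h"
    by (intro tendsto_cinner u tendsto_const)
  then have "cinner h h = 0"
    using assms(2) u(1) by (simp add: LIMSEQ_const_iff)
  then show ?thesis
    by (simp add: cinner_eq_zero_iff)
qed

text \<open>The difference of two candidates for \<open>h\<close> is orthogonal to the dense domain,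
  so \<open>h\<close> is unique. This eliminates the definite description in favour of a single
  condition on domain and value.\<close>

lemma adjoint_op_eq_iff:
  assumes "densely_defined T"
  shows "g \<in> opdom (adjoint_op T) \<and> opapp (adjoint_op T) g = h
    \<longleftrightarrow> (\<forall>f\<in>opdom T. cinner (opapp T f) g = cinner f h)"
proof -
  have uniq: "h = h'"
    if "\<forall>f\<in>opdom T. cinner (opapp T f) g = cinner f h"
      "\<forall>f\<in>opdom T. cinner (opapp T f) g = cinner f h'" for h h'
    using orthogonal_to_dense[OF assms, of "h - h'"] that by (simp add: cinner_diff_right)
  have "(THE h. \<forall>f\<in>opdom T. cinner (opapp T f) g = cinner f h) = h"
    if "\<forall>f\<in>opdom T. cinner (opapp T f) g = cinner f h" for h
    using that uniq by (intro the_equality) blast+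
  then show ?thesis
    unfolding adjoint_op_def by auto
qed

lemma cinner_adjoint_op:
  assumes "densely_defined T" "f \<in> opdom T" "g \<in> opdom (adjoint_op T)"
  shows "cinner (opapp T f) g = cinner f (opapp (adjoint_op T) g)"
  using adjoint_op_eq_iff[OF assms(1)] assms(2,3) by blast

lemma linear_adjoint_op:
  assumes "densely_defined T"
  shows "linear_op (adjoint_op T)"
proof -
  let ?S = "adjoint_op T"
  have 0: "0 \<in> opdom ?S \<and> opapp ?S 0 = 0"
    unfolding adjoint_op_eq_iff[OF assms] by simp
  have 1: "f + g \<in> opdom ?S \<and> opapp ?S (f + g) = opapp ?S f + opapp ?S g"
    if "f \<in> opdom ?S" "g \<in> opdom ?S" for f g
    unfolding adjoint_op_eq_iff[OF assms]
    using that by (simp add: cinner_add_right cinner_adjoint_op[OF assms])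
  have 2: "a *\<^sub>C f \<in> opdom ?S \<and> opapp ?S (a *\<^sub>C f) = a *\<^sub>C opapp ?S f"
    if "f \<in> opdom ?S" for a f
    unfolding adjoint_op_eq_iff[OF assms]
    using that by (simp add: cinner_scaleC_right cinner_adjoint_op[OF assms])
  show ?thesis
    unfolding linear_op_def using 0 1 2 by blast
qed

text \<open>The defining identity of the adjoint is continuous in the vector and in its image, so it
  survives limits of graph points.\<close>

lemma closed_adjoint_op:
  assumes "densely_defined T"
  shows "closed_op (adjoint_op T)"
  unfolding closed_op_def closed_sequential_limits
proof (intro allI impI, elim conjE)
  fix p l assume p: "\<forall>n. p n \<in> graph (adjoint_op T)" and lim: "p \<longlonglongrightarrow> l"
  have p': "fst (p n) \<in> opdom (adjoint_op T)" "snd (p n) = opapp (adjoint_op T) (fst (p n))" for n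
    using p[rule_format, of n] by auto
  have "cinner (opapp T f) (fst l) = cinner f (snd l)" if f: "f \<in> opdom T" for f
  proof (rule LIMSEQ_unique)
    show "(\<lambda>n. cinner (opapp T f) (fst (p n))) \<longlonglongrightarrow> cinner (opapp T f) (fst l)"
      by (intro tendsto_cinner tendsto_fst lim tendsto_const)
    show "(\<lambda>n. cinner (opapp T f) (fst (p n))) \<longlonglongrightarrow> cinner f (snd l)"
      unfolding cinner_adjoint_op[OF assms f p'(1)] p'(2)[symmetric]
      by (intro tendsto_cinner tendsto_snd lim tendsto_const)
  qed
  then have "fst l \<in> opdom (adjoint_op T) \<and> opapp (adjoint_op T) (fst l) = snd l"
    unfolding adjoint_op_eq_iff[OF assms] by blast
  then show "l \<in> graph (adjoint_op T)"
    by (auto simp: image_iff prod_eq_iff)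
qed

section \<open>The core property and its consequences\<close>

lemma csubspace_opdom_comp:
  assumes "linear_op S" "linear_op T"
  shows "csubspace (opdom (S \<circ>\<^sub>o T))"
  unfolding csubspace_def op_comp_def
  using linear_op_zero[OF assms(1)] linear_op_zero[OF assms(2)] linear_op_add[OF assms(1)]
    linear_op_add[OF assms(2)] linear_op_scaleC[OF assms(1)] linear_op_scaleC[OF assms(2)]
  by simp

text \<open>The component of \<open>(h, 0)\<close> along the graph of \<open>T\<close> is \<open>(g, T g)\<close> with \<open>g + T\<^sup>*T g = h\<close>.\<close>

lemma surj_one_plus_adjoint_comp_self:
  assumes "linear_op T" "closed_op T" "densely_defined T"
  obtains g where "g \<in> opdom (adjoint_op T \<circ>\<^sub>o T)" "g + opapp (adjoint_op T \<circ>\<^sub>o T) g = h"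
proof -
  obtain p where p: "p \<in> graph T" and orth: "\<And>q. q \<in> graph T \<Longrightarrow> cinner ((h, 0) - p) q = 0"
    using orthogonal_decomposition[of "graph T" "(h, 0)"] assms(2)
      csubspace_graph[OF assms(1) csubspace_opdom[OF assms(1)] order_refl]
    unfolding closed_op_def by blast
  obtain g where g: "g \<in> opdom T" and pg: "p = (g, opapp T g)"
    using p by blast
  \<comment> \<open>Orthogonality of \<open>(h - g, - T g)\<close> to \<open>(f, T f)\<close>,
    conjugated, is the defining identity of the adjoint at \<open>T g\<close> with value
    \<open>h - g\<close>.\<close>
  have "cinner (opapp T f) (opapp T g) = cinner f (h - g)" if "f \<in> opdom T" for f
  proof -
    have "cinner (h - g) f = cinner (opapp T g) (opapp T f)"
      using orth[of "(f, opapp T f)"] that by (simp add: pg cinner_prod_def cinner_minus_left)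
    then show ?thesis
      by (subst (1 2) cinner_commute) simp
  qed
  then have "opapp T g \<in> opdom (adjoint_op T) \<and> opapp (adjoint_op T) (opapp T g) = h - g"
    unfolding adjoint_op_eq_iff[OF assms(3)] by blast
  then show thesis
    using g by (intro that[of g]) (auto simp: op_comp_def)
qed

text \<open>Project \<open>(f, T f)\<close> onto the closure of the graph over the domain of
  \<open>T\<^sup>*T\<close>. The remainder \<open>(v, T v)\<close> is orthogonal to every
  \<open>(g, T g)\<close> from there, so \<open>v\<close> is orthogonal to every
  \<open>g + T\<^sup>*T g\<close>. Such vectors exhaust the space, hence
  \<open>v = 0\<close>.\<close>

lemma adjoint_comp_self_core:
  assumes "linear_op T" "closed_op T" "densely_defined T" "f \<in> opdom T"
  obtains u where "\<And>n. u n \<in> opdom (adjoint_op T \<circ>\<^sub>o T)" "u \<longlonglongrightarrow> f"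
    "(\<lambda>n. opapp T (u n)) \<longlonglongrightarrow> opapp T f"
proof -
  let ?D = "opdom (adjoint_op T \<circ>\<^sub>o T)"
  let ?G = "(\<lambda>f. (f, opapp T f)) ` ?D"
  have D: "?D \<subseteq> opdom T" "csubspace ?D"
    using csubspace_opdom_comp[OF linear_adjoint_op[OF assms(3)] assms(1)]
    by (auto simp: op_comp_def)
  note G = csubspace_graph[OF assms(1) D(2,1)]
  obtain p where p: "p \<in> closure ?G"
    and orth: "\<And>q. q \<in> closure ?G \<Longrightarrow> cinner ((f, opapp T f) - p) q = 0"
    using orthogonal_decomposition[OF csubspace_closure[OF G] closed_closure] by blast
  \<comment> \<open>Closedness of \<open>T\<close> keeps the projection inside the graph, so the
    remainder is a graph point as well.\<close>
  have "p \<in> graph T"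
    using p closure_minimal[of ?G "graph T"] D(1) assms(2) unfolding closed_op_def by blast
  then have "(f, opapp T f) - p \<in> graph T"
    using csubspace_diff[OF csubspace_graph[OF assms(1) csubspace_opdom[OF assms(1)] order_refl]]
      assms(4) by blast
  then obtain v where v: "v \<in> opdom T" "(f, opapp T f) - p = (v, opapp T v)"
    by blast
  obtain g where g: "g \<in> ?D" "g + opapp (adjoint_op T \<circ>\<^sub>o T) g = v"
    using surj_one_plus_adjoint_comp_self[OF assms(1-3)] by blast
  have "cinner v v = cinner v g + cinner (opapp T v) (opapp T g)"
    using g v(1) cinner_adjoint_op[OF assms(3), of v "opapp T g"]
    by (subst g(2)[symmetric]) (auto simp: op_comp_def cinner_add_right)
  also have "\<dots> = 0"
    using orth[of "(g, opapp T g)"] closure_subset[of ?G] g(1) v(2) by (auto simp: cinner_prod_def)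
  finally have "v = 0"
    by (simp add: cinner_eq_zero_iff)
  then have "(f, opapp T f) \<in> closure ?G"
    using p v(2) linear_op_zero[OF assms(1)] by (simp add: zero_prod_def[symmetric])
  then obtain q where q: "\<forall>n. q n \<in> ?G" "q \<longlonglongrightarrow> (f, opapp T f)"
    unfolding closure_sequential by blast
  show thesis
  proof (rule that[of "\<lambda>n. fst (q n)"])
    show "fst (q n) \<in> ?D" for n
      using q(1)[rule_format, of n] by auto
    show "(\<lambda>n. fst (q n)) \<longlonglongrightarrow> f"
      using tendsto_fst[OF q(2)] by simp
    have "opapp T (fst (q n)) = snd (q n)" for n
      using q(1)[rule_format, of n] by auto
    then show "(\<lambda>n. opapp T (fst (q n))) \<longlonglongrightarrow> opapp T f"
      using tendsto_snd[OF q(2)] by simp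
  qed
qed

text \<open>Thus \<open>T\<^sup>*T\<close> alone determines the norms of \<open>T\<close> on its
  domain, which allows two operators with the same \<open>T\<^sup>*T\<close> to be compared.\<close>

lemma norm_adjoint_comp_self:
  assumes "densely_defined T" "f \<in> opdom (adjoint_op T \<circ>\<^sub>o T)"
  shows "complex_of_real ((norm (opapp T f))\<^sup>2) = cinner f (opapp (adjoint_op T \<circ>\<^sub>o T) f)"
  using assms cinner_adjoint_op[of T f "opapp T f"] by (simp add: op_comp_def cinner_self)

text \<open>The norms agree on the common core. Approximating \<open>f\<close> from the core in the
  graph of \<open>S\<close> makes the images under \<open>T\<close> a Cauchy sequence, and
  closedness of \<open>T\<close> puts \<open>f\<close> into its domain.\<close>

lemma adjoint_comp_self_eq_imp_opdom_subset:
  assumes S: "linear_op S" "closed_op S" "densely_defined S"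
    and T: "linear_op T" "closed_op T" "densely_defined T"
    and eq: "adjoint_op S \<circ>\<^sub>o S \<approx>\<^sub>o adjoint_op T \<circ>\<^sub>o T"
    and f: "f \<in> opdom S"
  shows "f \<in> opdom T" "norm (opapp T f) = norm (opapp S f)"
proof -
  let ?D = "opdom (adjoint_op S \<circ>\<^sub>o S)"
  have D: "csubspace ?D" "?D \<subseteq> opdom S" "?D \<subseteq> opdom T"
    using csubspace_opdom_comp[OF linear_adjoint_op[OF S(3)] S(1)] op_eqD(1)[OF eq]
    by (simp_all add: op_comp_def) blast+
  have norm_eq: "norm (opapp T g) = norm (opapp S g)" if "g \<in> ?D" for g
  proof -
    have "complex_of_real ((norm (opapp T g))\<^sup>2) = complex_of_real ((norm (opapp S g))\<^sup>2)"
      using that op_eqD[OF eq] norm_adjoint_comp_self[OF S(3), of g] norm_adjoint_comp_self[OF T(3), of g]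
      by metis
    then show ?thesis
      by (simp only: of_real_eq_iff power2_eq_iff_nonneg norm_ge_zero)
  qed
  obtain u where u: "\<And>n. u n \<in> ?D" "u \<longlonglongrightarrow> f" "(\<lambda>n. opapp S (u n)) \<longlonglongrightarrow> opapp S f"
    using adjoint_comp_self_core[OF S f] by blast
  have uS: "u n \<in> opdom S" and uT: "u n \<in> opdom T" for n
    using u(1) D by blast+
  \<comment> \<open>Differences of core elements stay in the core, so equality of norms there
    becomes equality of distances.\<close>
  have "dist (opapp T (u m)) (opapp T (u n)) = dist (opapp S (u m)) (opapp S (u n))" for m n
    using norm_eq[OF csubspace_diff[OF D(1) u(1)[of m] u(1)[of n]]]
      linear_op_diff[OF S(1) uS[of m] uS[of n]] linear_op_diff[OF T(1) uT[of m] uT[of n]]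
    by (simp add: dist_norm)
  then have "Cauchy (\<lambda>n. opapp T (u n))"
    using LIMSEQ_imp_Cauchy[OF u(3)] by (simp add: Cauchy_def)
  then obtain y where y: "(\<lambda>n. opapp T (u n)) \<longlonglongrightarrow> y"
    using convergent_eq_Cauchy by blast
  show "f \<in> opdom T"
    using closed_opD(1)[OF T(2) uT u(2) y] .
  have "opapp T f = y"
    using closed_opD(2)[OF T(2) uT u(2) y] .
  moreover have "norm y = norm (opapp S f)"
    using tendsto_norm[OF y] tendsto_norm[OF u(3)] norm_eq[OF u(1)] LIMSEQ_unique by simp
  ultimately show "norm (opapp T f) = norm (opapp S f)"
    by simp
qed

section \<open>Domain and norms of the modulus\<close>

lemma selfadjoint_op_closed:
  assumes "selfadjoint_op T"
  shows "closed_op T"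
proof -
  have "graph T = graph (adjoint_op T)"
    using op_eqD[of T "adjoint_op T"] assms unfolding selfadjoint_op_def by (intro image_cong) auto
  then show ?thesis
    using closed_adjoint_op assms unfolding closed_op_def selfadjoint_op_def by metis
qed

text \<open>As \<open>R\<close> is selfadjoint, \<open>R\<^sup>*R\<close> is the square of
  \<open>R\<close> and hence equals \<open>A\<^sup>*A\<close>. The comparison of operators, used in
  both directions, gives equal domains.\<close>

lemma modulus_opdom_norm:
  assumes A: "linear_op A" "closed_op A" "densely_defined A" and R: "is_modulus A R"
  shows "opdom R = opdom A" "f \<in> opdom A \<Longrightarrow> norm (opapp R f) = norm (opapp A f)"
proof -
  have sa: "selfadjoint_op R" and sq: "R \<circ>\<^sub>o R \<approx>\<^sub>o adjoint_op A \<circ>\<^sub>o A"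
    using R by (auto simp: is_modulus_def is_square_root_def)
  note R' = sa[unfolded selfadjoint_op_def, THEN conjunct1] selfadjoint_op_closed[OF sa]
    sa[unfolded selfadjoint_op_def, THEN conjunct2, THEN conjunct1]
  have 1: "adjoint_op R \<circ>\<^sub>o R \<approx>\<^sub>o adjoint_op A \<circ>\<^sub>o A"
    using op_comp_cong_left sa sq unfolding selfadjoint_op_def by (blast intro: op_eq_sym op_eq_trans)
  note 2 = op_eq_sym[OF 1]
  show "opdom R = opdom A"
    using adjoint_comp_self_eq_imp_opdom_subset(1)[OF A R' 2]
      adjoint_comp_self_eq_imp_opdom_subset(1)[OF R' A 1] by blast
  show "f \<in> opdom A \<Longrightarrow> norm (opapp R f) = norm (opapp A f)"
    using adjoint_comp_self_eq_imp_opdom_subset(2)[OF A R' 2] by blast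
qed

section \<open>Spectral measures and spectral integrals\<close>

lemma orthogonal_projectionD:
  assumes "orthogonal_projection P"
  shows "P (f + g) = P f + P g" "P (a *\<^sub>C f) = a *\<^sub>C P f" "P (P f) = P f"
    "cinner (P f) g = cinner f (P g)"
  using assms unfolding orthogonal_projection_def by blast+

lemma orthogonal_projection_diff:
  assumes "orthogonal_projection P"
  shows "P (f - g) = P f - P g"
  using orthogonal_projectionD(1)[OF assms, of "f - g" g] by simp

lemma orthogonal_projection_zero: "orthogonal_projection P \<Longrightarrow> P 0 = 0"
  using orthogonal_projection_diff[of P 0 0] by simp

lemma orthogonal_projection_sum:
  assumes "orthogonal_projection P"
  shows "P (\<Sum>i\<in>I. f i) = (\<Sum>i\<in>I. P (f i))"
  by (induction I rule: infinite_finite_induct)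
    (simp_all add: orthogonal_projectionD(1)[OF assms] orthogonal_projection_zero[OF assms])

lemma cinner_orthogonal_projection:
  assumes "orthogonal_projection P"
  shows "cinner (P f) f = complex_of_real ((norm (P f))\<^sup>2)"
  using orthogonal_projectionD(3,4)[OF assms] by (metis cinner_self)

lemma norm_orthogonal_projection_squared:
  assumes "orthogonal_projection P"
  shows "(norm (P f))\<^sup>2 + (norm (f - P f))\<^sup>2 = (norm f)\<^sup>2"
proof -
  have "cinner (P f) (f - P f) = 0"
    by (simp add: orthogonal_projectionD[OF assms] orthogonal_projection_diff[OF assms])
  then show ?thesis
    using norm_add_squared[of "P f" "f - P f"] by simp
qed

lemma norm_orthogonal_projection_le:
  assumes "orthogonal_projection P"
  shows "norm (P f) \<le> norm f"
proof (rule power2_le_imp_le)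
  show "(norm (P f))\<^sup>2 \<le> (norm f)\<^sup>2"
    using norm_orthogonal_projection_squared[OF assms, of f] zero_le_power2[of "norm (f - P f)"]
    by linarith
qed simp

lemma tendsto_orthogonal_projection:
  assumes "orthogonal_projection P" "(u \<longlongrightarrow> x) F"
  shows "((\<lambda>n. P (u n)) \<longlongrightarrow> P x) F"
proof (rule bounded_linear.tendsto[OF bounded_linear_intro[where K = 1] assms(2)])
  show "norm (P f) \<le> norm f * 1" for f
    by (simp add: norm_orthogonal_projection_le[OF assms(1)])
qed (simp_all add: scaleR_eq_scaleC orthogonal_projectionD[OF assms(1)])

section \<open>Algebra of a spectral measure\<close>

context
  fixes M :: "'b measure" and E :: "'b set \<Rightarrow> 'a::complex_hilbert \<Rightarrow> 'a"
  assumes E: "spectral_measure M E"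
begin

lemma spectral_measure_projection: "\<sigma> \<in> sets M \<Longrightarrow> orthogonal_projection (E \<sigma>)"
  using E unfolding spectral_measure_def by blast

lemma spectral_measure_space: "E (space M) f = f"
  using E unfolding spectral_measure_def by blast

lemma spectral_measure_sums:
  assumes "range S \<subseteq> sets M" "disjoint_family (S :: nat \<Rightarrow> 'b set)"
  shows "(\<lambda>n. E (S n) f) sums E (\<Union>n. S n) f"
  using E assms unfolding spectral_measure_def by blast

text \<open>Countable additivity on the constant empty family makes a constant series summable, so
  its terms tend to zero.\<close>

lemma spectral_measure_empty: "E {} f = 0"
proof -
  have "(\<lambda>n::nat. E {} f) sums E {} f"
    using spectral_measure_sums[of "\<lambda>_. {}" f] by (simp add: disjoint_family_on_def)
  then have "(\<lambda>n::nat. E {} f) \<longlonglongrightarrow> 0"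
    using summable_LIMSEQ_zero sums_summable by blast
  then show ?thesis
    by (simp add: LIMSEQ_const_iff)
qed

lemma spectral_measure_Un:
  assumes "\<sigma> \<in> sets M" "\<tau> \<in> sets M" "\<sigma> \<inter> \<tau> = {}"
  shows "E (\<sigma> \<union> \<tau>) f = E \<sigma> f + E \<tau> f"
proof (rule sums_unique2)
  show "(\<lambda>n. E (binaryset \<sigma> \<tau> n) f) sums E (\<sigma> \<union> \<tau>) f"
  proof -
    have "disjoint_family (binaryset \<sigma> \<tau>)"
      using assms(3) by (auto simp: disjoint_family_on_def binaryset_def)
    then show ?thesis
      using spectral_measure_sums[of "binaryset \<sigma> \<tau>" f] assms(1,2)
      by (simp add: range_binaryset_eq UN_binaryset_eq)
  qed
  show "(\<lambda>n. E (binaryset \<sigma> \<tau> n) f) sums (E \<sigma> f + E \<tau> f)"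
    by (rule binaryset_sums[where f = "\<lambda>\<sigma>. E \<sigma> f"]) (rule spectral_measure_empty)
qed

lemma spectral_measure_Diff:
  assumes "\<sigma> \<in> sets M"
  shows "E (space M - \<sigma>) f = f - E \<sigma> f"
proof -
  have "\<sigma> \<union> (space M - \<sigma>) = space M"
    using sets.sets_into_space[OF assms] by blast
  then have "f = E \<sigma> f + E (space M - \<sigma>) f"
    using spectral_measure_Un[of \<sigma> "space M - \<sigma>" f] spectral_measure_space[of f] assms by auto
  then show ?thesis
    by (simp add: algebra_simps)
qed

text \<open>Since \<open>E(\<sigma>) + E(\<tau>)\<close> is a projection, it cannot increase the norm of \<open>E(\<tau>)f\<close>.\<close>

lemma spectral_measure_disjoint:
  assumes "\<sigma> \<in> sets M" "\<tau> \<in> sets M" "\<sigma> \<inter> \<tau> = {}"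
  shows "E \<sigma> (E \<tau> f) = 0"
proof -
  note P = spectral_measure_projection
  let ?g = "E \<tau> f"
  have un: "\<sigma> \<union> \<tau> \<in> sets M"
    using assms by blast
  \<comment> \<open>The projection \<open>E \<tau>\<close> fixes \<open>?g\<close>, so pairing
    \<open>E (\<sigma> \<union> \<tau>) ?g\<close> with \<open>?g\<close> yields the full squared
    norm of \<open>?g\<close> as second summand.\<close>
  have "complex_of_real ((norm (E (\<sigma> \<union> \<tau>) ?g))\<^sup>2)
      = complex_of_real ((norm (E \<sigma> ?g))\<^sup>2) + complex_of_real ((norm ?g)\<^sup>2)"
    unfolding cinner_orthogonal_projection[OF P[OF un], symmetric]
      cinner_orthogonal_projection[OF P[OF assms(1)], symmetric]
    by (simp add: spectral_measure_Un[OF assms] cinner_add_left orthogonal_projectionD(3)[OF P[OF assms(2)]]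
        cinner_self)
  then have "(norm (E (\<sigma> \<union> \<tau>) ?g))\<^sup>2 = (norm (E \<sigma> ?g))\<^sup>2 + (norm ?g)\<^sup>2"
    by (simp only: of_real_eq_iff flip: of_real_add)
  moreover have "(norm (E (\<sigma> \<union> \<tau>) ?g))\<^sup>2 \<le> (norm ?g)\<^sup>2"
    by (intro power_mono norm_orthogonal_projection_le P un) simp
  ultimately show ?thesis
    by simp
qed

lemma spectral_measure_split:
  assumes "\<sigma> \<in> sets M" "\<tau> \<in> sets M"
  shows "E \<sigma> f = E (\<sigma> \<inter> \<tau>) f + E (\<sigma> - \<tau>) f"
proof -
  have "\<sigma> \<inter> \<tau> \<inter> (\<sigma> - \<tau>) = {}"
    by blast
  then show ?thesis
    using spectral_measure_Un[of "\<sigma> \<inter> \<tau>" "\<sigma> - \<tau>" f] assms by (simp add: Int_Diff_Un)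
qed

text \<open>Multiplicativity is derived from additivity: after splitting both sets, only the common
  part survives, because projections over disjoint sets annihilate each other.\<close>

lemma spectral_measure_Int:
  assumes "\<sigma> \<in> sets M" "\<tau> \<in> sets M"
  shows "E \<sigma> (E \<tau> f) = E (\<sigma> \<inter> \<tau>) f"
proof -
  note P = spectral_measure_projection
  have \<rho>: "\<tau> \<inter> \<sigma> \<in> sets M" "\<tau> - \<sigma> \<in> sets M" "\<sigma> - \<tau> \<in> sets M"
    using assms by auto
  have "E \<sigma> (E \<tau> f) = E \<sigma> (E (\<tau> \<inter> \<sigma>) f) + E \<sigma> (E (\<tau> - \<sigma>) f)"
    by (simp add: spectral_measure_split[OF assms(2,1), of f] orthogonal_projectionD(1)[OF P[OF assms(1)]])
  also have "E \<sigma> (E (\<tau> - \<sigma>) f) = 0"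
    using assms \<rho> by (intro spectral_measure_disjoint) auto
  also have "E \<sigma> (E (\<tau> \<inter> \<sigma>) f) = E (\<sigma> \<inter> \<tau>) (E (\<tau> \<inter> \<sigma>) f) + E (\<sigma> - \<tau>) (E (\<tau> \<inter> \<sigma>) f)"
    by (rule spectral_measure_split[OF assms])
  also have "E (\<sigma> - \<tau>) (E (\<tau> \<inter> \<sigma>) f) = 0"
    using \<rho> by (intro spectral_measure_disjoint) auto
  finally show ?thesis
    using orthogonal_projectionD(3)[OF P[OF \<rho>(1)], of f] by (simp add: Int_commute)
qed

lemma spectral_measure_commute:
  "\<sigma> \<in> sets M \<Longrightarrow> \<tau> \<in> sets M \<Longrightarrow> E \<sigma> (E \<tau> f) = E \<tau> (E \<sigma> f)"
  by (simp add: spectral_measure_Int Int_commute)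

lemma spectral_measure_UN:
  assumes "finite I" "\<And>i. i \<in> I \<Longrightarrow> A i \<in> sets M" "disjoint_family_on A I"
  shows "E (\<Union>i\<in>I. A i) f = (\<Sum>i\<in>I. E (A i) f)"
  using assms
proof (induction I rule: finite_induct)
  case empty
  then show ?case by (simp add: spectral_measure_empty)
next
  case (insert i I)
  have "A i \<inter> (\<Union>j\<in>I. A j) = {}"
    using insert.prems(2) insert.hyps(2) by (auto simp: disjoint_family_on_def)
  then have "E (A i \<union> (\<Union>j\<in>I. A j)) f = E (A i) f + E (\<Union>j\<in>I. A j) f"
    using insert.prems(1) insert.hyps(1) by (intro spectral_measure_Un) auto
  then show ?case
    using insert by (simp add: disjoint_family_on_insert)
qed

text \<open>Pythagoras, because projections over disjoint sets have orthogonal ranges.\<close>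

lemma norm_sum_spectral_measure_squared:
  assumes "finite I" "\<And>i. i \<in> I \<Longrightarrow> A i \<in> sets M" "disjoint_family_on A I"
  shows "(norm (\<Sum>i\<in>I. a i *\<^sub>C E (A i) f))\<^sup>2 = (\<Sum>i\<in>I. (cmod (a i))\<^sup>2 * (norm (E (A i) f))\<^sup>2)"
  using assms
proof (induction I rule: finite_induct)
  case (insert i I)
  have "E (A i) (\<Sum>j\<in>I. a j *\<^sub>C E (A j) f) = (\<Sum>j\<in>I. a j *\<^sub>C E (A i) (E (A j) f))"
    using insert.prems(1)
    by (simp add: orthogonal_projection_sum[OF spectral_measure_projection]
        orthogonal_projectionD(2)[OF spectral_measure_projection])
  also have "\<dots> = 0"
    using insert.prems insert.hyps(2)
    by (intro sum.neutral ballI) (subst spectral_measure_disjoint; auto simp: disjoint_family_on_def)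
  finally have "cinner (a i *\<^sub>C E (A i) f) (\<Sum>j\<in>I. a j *\<^sub>C E (A j) f) = 0"
    using insert.prems(1)
    by (simp add: cinner_scaleC_left orthogonal_projectionD(4)[OF spectral_measure_projection])
  then show ?case
    using insert
    by (simp add: norm_add_squared norm_scaleC power_mult_distrib disjoint_family_on_insert)
qed simp

section \<open>Scalar measures and integrals of simple functions\<close>

lemma sets_scalar_measure [simp, measurable_cong]: "sets (scalar_measure M E f) = sets M"
  by (simp add: scalar_measure_def)

lemma space_scalar_measure [simp]: "space (scalar_measure M E f) = space M"
  by (simp add: scalar_measure_def)

text \<open>For \<open>measure_of\<close> to take the intended values, countable additivity has to
  be checked; it passes from strong convergence of the projections to the quadratic form by
  continuity.\<close>

lemma emeasure_scalar_measure:
  assumes "\<sigma> \<in> sets M"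
  shows "emeasure (scalar_measure M E f) \<sigma> = ennreal ((norm (E \<sigma> f))\<^sup>2)"
proof -
  have Re_eq: "Re (cinner (E \<sigma> f) f) = (norm (E \<sigma> f))\<^sup>2" if "\<sigma> \<in> sets M" for \<sigma>
    by (simp add: cinner_orthogonal_projection[OF spectral_measure_projection[OF that]])
  have "countably_additive (sets M) (\<lambda>\<sigma>. ennreal (Re (cinner (E \<sigma> f) f)))"
  proof (rule countably_additiveI)
    fix S :: "nat \<Rightarrow> 'b set"
    assume S: "range S \<subseteq> sets M" "disjoint_family S"
    have "(\<lambda>n. Re (cinner (E (S n) f) f)) sums Re (cinner (E (\<Union>n. S n) f) f)"
      by (intro bounded_linear.sums[OF bounded_linear_Re]
          bounded_linear.sums[OF bounded_bilinear.bounded_linear_left[OF bounded_bilinear_cinner]]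
          spectral_measure_sums S)
    then show "(\<Sum>n. ennreal (Re (cinner (E (S n) f) f))) = ennreal (Re (cinner (E (\<Union>n. S n) f) f))"
      using S(1) by (intro suminf_ennreal_eq) (auto simp: Re_eq)
  qed
  moreover have "positive (sets M) (\<lambda>\<sigma>. ennreal (Re (cinner (E \<sigma> f) f)))"
    by (simp add: positive_def spectral_measure_empty)
  ultimately show ?thesis
    unfolding scalar_measure_def using assms
    by (simp add: emeasure_measure_of_sigma sets.sigma_algebra_axioms Re_eq)
qed

text \<open>Since \<open>E \<sigma>\<close> commutes with every \<open>E \<tau>\<close> and does not
  increase norms, the scalar measure of \<open>E \<sigma> f\<close> is dominated setwise by that of
  \<open>f\<close>.\<close>

lemma scalar_measure_projection_le:
  assumes "\<sigma> \<in> sets M"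
  shows "nn_integral (scalar_measure M E (E \<sigma> f)) u \<le> nn_integral (scalar_measure M E f) u"
proof (rule nn_integral_mono_measure)
  have "emeasure (scalar_measure M E (E \<sigma> f)) \<tau> \<le> emeasure (scalar_measure M E f) \<tau>" if "\<tau> \<in> sets M" for \<tau>
    unfolding emeasure_scalar_measure[OF that] spectral_measure_commute[OF that assms]
    by (intro ennreal_leI power_mono norm_orthogonal_projection_le spectral_measure_projection assms) simp
  then show "scalar_measure M E (E \<sigma> f) \<le> scalar_measure M E f"
    by (simp add: le_measure)
qed simp

text \<open>A simple function that factors through \<open>p\<close> may be integrated over the level sets of \<open>p\<close>;
  with \<open>p = (s, t)\<close> two simple functions get a common partition.\<close>

lemma simple_spectral_integral_comp:
  assumes p: "simple_function M p"
  shows "simple_spectral_integral M E (\<lambda>x. k (p x)) f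
    = (\<Sum>c\<in>p ` space M. k c *\<^sub>C E (p -` {c} \<inter> space M) f)"
proof -
  note fin = simple_functionD(1)[OF p]
  have "(\<Sum>c\<in>p ` space M. k c *\<^sub>C E (p -` {c} \<inter> space M) f)
      = (\<Sum>y\<in>k ` p ` space M. \<Sum>c | c \<in> p ` space M \<and> k c = y. k c *\<^sub>C E (p -` {c} \<inter> space M) f)"
    by (rule sum.image_gen[OF fin])
  also have "\<dots> = (\<Sum>y\<in>k ` p ` space M. y *\<^sub>C E ((\<lambda>x. k (p x)) -` {y} \<inter> space M) f)"
  proof (rule sum.cong[OF refl])
    fix y
    let ?C = "{c \<in> p ` space M. k c = y}"
    have "(\<lambda>x. k (p x)) -` {y} \<inter> space M = (\<Union>c\<in>?C. p -` {c} \<inter> space M)"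
      by auto
    also have "E \<dots> f = (\<Sum>c\<in>?C. E (p -` {c} \<inter> space M) f)"
      using fin by (intro spectral_measure_UN simple_functionD(2)[OF p])
        (auto simp: disjoint_family_on_def)
    finally show "(\<Sum>c\<in>?C. k c *\<^sub>C E (p -` {c} \<inter> space M) f)
        = y *\<^sub>C E ((\<lambda>x. k (p x)) -` {y} \<inter> space M) f"
      by (simp add: scaleC_sum_right)
  qed
  finally show ?thesis
    by (simp add: simple_spectral_integral_def image_image)
qed

text \<open>The isometry behind the spectral integral. On each level set of the pair
  \<open>(s, t)\<close> the difference is a constant \<open>d c\<close>, so both sides equal the
  same finite sum.\<close>

lemma norm_simple_spectral_integral_diff:
  assumes s: "simple_function M s" and t: "simple_function M t"
  shows "ennreal ((norm (simple_spectral_integral M E s f - simple_spectral_integral M E t f))\<^sup>2)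
    = (\<integral>\<^sup>+ x. ennreal ((cmod (s x - t x))\<^sup>2) \<partial>scalar_measure M E f)"
proof -
  let ?\<mu> = "scalar_measure M E f"
  define p where "p = (\<lambda>x. (s x, t x))"
  define C where "C = p ` space M"
  define A where "A c = p -` {c} \<inter> space M" for c
  define d :: "complex \<times> complex \<Rightarrow> complex" where "d c = fst c - snd c" for c
  have p: "simple_function M p"
    unfolding p_def by (intro simple_function_Pair s t)
  have C: "finite C" and A: "\<And>c. A c \<in> sets M" and dA: "disjoint_family_on A C"
    using simple_functionD[OF p] by (auto simp: C_def A_def disjoint_family_on_def)
  have "simple_spectral_integral M E s f - simple_spectral_integral M E t f
      = (\<Sum>c\<in>C. d c *\<^sub>C E (A c) f)"
    using simple_spectral_integral_comp[OF p, of fst f] simple_spectral_integral_comp[OF p, of snd f]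
    by (simp add: p_def[symmetric] C_def A_def d_def scaleC_diff_left sum_subtractf)
      (simp add: p_def)
  then have "ennreal ((norm (simple_spectral_integral M E s f - simple_spectral_integral M E t f))\<^sup>2)
      = (\<Sum>c\<in>C. ennreal ((cmod (d c))\<^sup>2) * emeasure ?\<mu> (A c))"
    by (simp add: norm_sum_spectral_measure_squared[OF C A dA] emeasure_scalar_measure[OF A]
        ennreal_mult sum_nonneg flip: sum_ennreal)
  also have "\<dots> = (\<integral>\<^sup>+ x. (\<Sum>c\<in>C. ennreal ((cmod (d c))\<^sup>2) * indicator (A c) x) \<partial>?\<mu>)"
    using A by (subst nn_integral_sum) (simp_all add: nn_integral_cmult_indicator)
  also have "\<dots> = (\<integral>\<^sup>+ x. ennreal ((cmod (s x - t x))\<^sup>2) \<partial>?\<mu>)"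
  proof (rule nn_integral_cong)
    fix x assume x: "x \<in> space ?\<mu>"
    \<comment> \<open>Level sets are disjoint, so at \<open>x\<close> only the block
      \<open>c = p x\<close> contributes.\<close>
    have "(\<Sum>c\<in>C. ennreal ((cmod (d c))\<^sup>2) * indicator (A c) x)
        = (\<Sum>c\<in>C. if c = p x then ennreal ((cmod (d c))\<^sup>2) else 0)"
      using x by (intro sum.cong) (auto simp: A_def indicator_def)
    then show "(\<Sum>c\<in>C. ennreal ((cmod (d c))\<^sup>2) * indicator (A c) x) = ennreal ((cmod (s x - t x))\<^sup>2)"
      using x C by (simp add: d_def) (auto simp: C_def p_def)
  qed
  finally show ?thesis .
qed

lemma simple_spectral_integral_projection:
  assumes "simple_function M s" "\<sigma> \<in> sets M"
  shows "simple_spectral_integral M E s (E \<sigma> f) = E \<sigma> (simple_spectral_integral M E s f)"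
proof -
  have "E (s -` {y} \<inter> space M) (E \<sigma> f) = E \<sigma> (E (s -` {y} \<inter> space M) f)" for y
    by (intro spectral_measure_commute simple_functionD(2) assms)
  then show ?thesis
    unfolding simple_spectral_integral_def
    by (simp add: orthogonal_projection_sum[OF spectral_measure_projection[OF assms(2)]]
        orthogonal_projectionD(2)[OF spectral_measure_projection[OF assms(2)]])
qed

section \<open>Spectral integrals of measurable functions\<close>

definition L2_approx :: "'a \<Rightarrow> ('b \<Rightarrow> complex) \<Rightarrow> (nat \<Rightarrow> 'b \<Rightarrow> complex) \<Rightarrow> bool" where
  "L2_approx f h s \<longleftrightarrow> (\<forall>n. simple_function M (s n)) \<and>
    (\<lambda>n. \<integral>\<^sup>+ x. ennreal ((cmod (s n x - h x))\<^sup>2) \<partial>scalar_measure M E f) \<longlonglongrightarrow> 0"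

lemma spectral_integral_eq:
  "spectral_integral M E h = Unbdd_Op
    {f. (\<integral>\<^sup>+ x. ennreal ((cmod (h x))\<^sup>2) \<partial>scalar_measure M E f) < \<infinity>}
    (\<lambda>f. THE g. \<forall>s. L2_approx f h s \<longrightarrow> (\<lambda>n. simple_spectral_integral M E (s n) f) \<longlonglongrightarrow> g)"
  unfolding spectral_integral_def L2_approx_def by (simp add: imp_conjL)

text \<open>Measurable functions are pointwise limits of simple ones with
  \<open>cmod (s n x)\<close> at most \<open>2 * cmod (h x)\<close>. Membership of \<open>f\<close>
  in the domain is the integrability that dominated convergence asks for.\<close>

lemma L2_approx_exists:
  assumes h [measurable]: "h \<in> borel_measurable M" and f: "f \<in> opdom (spectral_integral M E h)"
  obtains s where "L2_approx f h s"
proof -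
  let ?\<mu> = "scalar_measure M E f"
  obtain s where s: "\<And>n. simple_function M (s n)"
    and lim: "\<And>x. x \<in> space M \<Longrightarrow> (\<lambda>n. s n x) \<longlonglongrightarrow> h x"
    and bound: "\<And>n x. x \<in> space M \<Longrightarrow> dist (s n x) 0 \<le> 2 * dist (h x) 0"
    using borel_measurable_implies_sequence_metric[OF h, of 0] by blast
  have [measurable]: "s n \<in> borel_measurable M" for n
    by (rule borel_measurable_simple_function[OF s])
  have "(\<lambda>n. \<integral>\<^sup>+ x. ennreal ((cmod (s n x - h x))\<^sup>2) \<partial>?\<mu>) \<longlonglongrightarrow> (\<integral>\<^sup>+ x. 0 \<partial>?\<mu>)"
  \<comment> \<open>The factor 9 is the square of 2 + 1, from the triangle inequality and the bound
    on \<open>s n\<close>.\<close>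
  proof (rule nn_integral_dominated_convergence[where w = "\<lambda>x. 9 * ennreal ((cmod (h x))\<^sup>2)"])
    show "AE x in ?\<mu>. ennreal ((cmod (s n x - h x))\<^sup>2) \<le> 9 * ennreal ((cmod (h x))\<^sup>2)" for n
    proof (rule AE_I2)
      fix x assume "x \<in> space ?\<mu>"
      then have "cmod (s n x - h x) \<le> 3 * cmod (h x)"
        using bound[of x n] norm_triangle_ineq4[of "s n x" "h x"] by simp
      then have "(cmod (s n x - h x))\<^sup>2 \<le> (3 * cmod (h x))\<^sup>2"
        by (intro power_mono) simp_all
      then have "ennreal ((cmod (s n x - h x))\<^sup>2) \<le> ennreal (9 * (cmod (h x))\<^sup>2)"
        by (intro ennreal_leI) (simp add: power_mult_distrib)
      then show "ennreal ((cmod (s n x - h x))\<^sup>2) \<le> 9 * ennreal ((cmod (h x))\<^sup>2)"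
        by (simp add: ennreal_mult)
    qed
    show "(\<integral>\<^sup>+ x. 9 * ennreal ((cmod (h x))\<^sup>2) \<partial>?\<mu>) < \<infinity>"
      using f by (simp add: nn_integral_cmult spectral_integral_def ennreal_mult_less_top)
    show "AE x in ?\<mu>. (\<lambda>n. ennreal ((cmod (s n x - h x))\<^sup>2)) \<longlonglongrightarrow> 0"
    proof (rule AE_I2)
      fix x assume "x \<in> space ?\<mu>"
      then have "(\<lambda>n. (cmod (s n x - h x))\<^sup>2) \<longlonglongrightarrow> (cmod (h x - h x))\<^sup>2"
        by (intro tendsto_intros lim) simp
      then show "(\<lambda>n. ennreal ((cmod (s n x - h x))\<^sup>2)) \<longlonglongrightarrow> 0"
        using tendsto_ennrealI by fastforce
    qed
  qed measurable
  then show thesis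
    using s by (intro that[of s]) (simp add: L2_approx_def)
qed

text \<open>The isometry turns the left side into an integral, and
  \<open>(a + b)\<^sup>2 \<le> 2 * a\<^sup>2 + 2 * b\<^sup>2\<close> separates the two approximation
  errors.\<close>

lemma simple_spectral_integral_diff_le:
  assumes [measurable]: "h \<in> borel_measurable M"
    and s: "simple_function M s" and t: "simple_function M t"
  shows "ennreal ((norm (simple_spectral_integral M E s f - simple_spectral_integral M E t f))\<^sup>2)
    \<le> 2 * (\<integral>\<^sup>+ x. ennreal ((cmod (s x - h x))\<^sup>2) \<partial>scalar_measure M E f)
      + 2 * (\<integral>\<^sup>+ x. ennreal ((cmod (t x - h x))\<^sup>2) \<partial>scalar_measure M E f)"
proof -
  have [measurable]: "s \<in> borel_measurable M" "t \<in> borel_measurable M"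
    using s t by (auto intro: borel_measurable_simple_function)
  have "ennreal ((cmod (s x - t x))\<^sup>2)
      \<le> 2 * ennreal ((cmod (s x - h x))\<^sup>2) + 2 * ennreal ((cmod (t x - h x))\<^sup>2)" for x
  proof -
    have "(cmod (s x - t x))\<^sup>2 \<le> (cmod (s x - h x) + cmod (t x - h x))\<^sup>2"
      using norm_triangle_ineq4[of "s x - h x" "t x - h x"] by (intro power_mono) simp_all
    also have "\<dots> \<le> 2 * (cmod (s x - h x))\<^sup>2 + 2 * (cmod (t x - h x))\<^sup>2"
      using zero_le_power2[of "cmod (s x - h x) - cmod (t x - h x)"] by (simp add: power2_sum power2_diff)
    finally have "ennreal ((cmod (s x - t x))\<^sup>2)
        \<le> ennreal (2 * (cmod (s x - h x))\<^sup>2 + 2 * (cmod (t x - h x))\<^sup>2)"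
      by (rule ennreal_leI)
    then show ?thesis
      by (simp add: ennreal_plus ennreal_mult)
  qed
  then show ?thesis
    unfolding norm_simple_spectral_integral_diff[OF s t]
    by (subst (1 2) nn_integral_cmult[symmetric], simp, simp, subst nn_integral_add[symmetric])
      (auto intro: nn_integral_mono)
qed

text \<open>The description in \<open>spectral_integral\<close> is well posed: one approximating
  sequence exists and has convergent integrals, and every other one leads to the same limit.\<close>

lemma spectral_integral_LIMSEQ:
  assumes h: "h \<in> borel_measurable M" and f: "f \<in> opdom (spectral_integral M E h)"
    and s: "L2_approx f h s"
  shows "(\<lambda>n. simple_spectral_integral M E (s n) f) \<longlonglongrightarrow> opapp (spectral_integral M E h) f"
proof -
  let ?J = "\<lambda>s. simple_spectral_integral M E s f"
  let ?e = "\<lambda>s n. \<integral>\<^sup>+ x. ennreal ((cmod (s n x - h x))\<^sup>2) \<partial>scalar_measure M E f"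
  have diff: "ennreal ((norm (?J (t m) - ?J (s n)))\<^sup>2) \<le> 2 * ?e t m + 2 * ?e s n"
    if "L2_approx f h t" "L2_approx f h s" for s t :: "nat \<Rightarrow> 'b \<Rightarrow> complex" and m n
    using that by (intro simple_spectral_integral_diff_le h) (auto simp: L2_approx_def)
  obtain t where t: "L2_approx f h t"
    using L2_approx_exists[OF h f] .
  have "Cauchy (\<lambda>n. ?J (t n))"
  proof (rule metric_CauchyI)
    fix r :: real assume r: "0 < r"
    \<comment> \<open>Two errors below \<open>r\<^sup>2 / 4\<close>, each doubled, add up to less
      than \<open>r\<^sup>2\<close>.\<close>
    have "eventually (\<lambda>n. ?e t n < ennreal (r\<^sup>2 / 4)) sequentially"
      using t r by (intro order_tendstoD(2)[where y = 0]) (auto simp: L2_approx_def)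
    then obtain N where N: "\<And>n. n \<ge> N \<Longrightarrow> ?e t n < ennreal (r\<^sup>2 / 4)"
      by (auto simp: eventually_sequentially)
    have "dist (?J (t m)) (?J (t n)) < r" if "m \<ge> N" "n \<ge> N" for m n
    proof -
      have "ennreal ((norm (?J (t m) - ?J (t n)))\<^sup>2) \<le> 2 * ?e t m + 2 * ?e t n"
        by (rule diff[OF t t])
      also have "\<dots> < 2 * ennreal (r\<^sup>2 / 4) + 2 * ennreal (r\<^sup>2 / 4)"
        by (intro add_strict_mono ennreal_mult_strict_left_mono N that) simp_all
      also have "\<dots> = ennreal (r\<^sup>2)"
        by (simp flip: ennreal_plus ennreal_mult'' ennreal_numeral)
      finally have "(norm (?J (t m) - ?J (t n)))\<^sup>2 < r\<^sup>2"
        by (simp add: ennreal_less_iff)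
      then show ?thesis
        using r by (simp add: dist_norm power2_less_imp_less)
    qed
    then show "\<exists>K. \<forall>m\<ge>K. \<forall>n\<ge>K. dist (?J (t m)) (?J (t n)) < r"
      by blast
  qed
  then obtain g where g: "(\<lambda>n. ?J (t n)) \<longlonglongrightarrow> g"
    using convergent_eq_Cauchy by blast
  \<comment> \<open>An arbitrary approximating sequence is compared termwise with \<open>t\<close>;
    the integrals differ by a null sequence.\<close>
  have lim: "(\<lambda>n. ?J (s n)) \<longlonglongrightarrow> g" if s: "L2_approx f h s" for s
  proof -
    have "(\<lambda>n. 2 * ?e s n + 2 * ?e t n) \<longlonglongrightarrow> 2 * 0 + 2 * 0"
      using s t by (intro tendsto_add ennreal_tendsto_cmult) (auto simp: L2_approx_def)
    then have lim: "(\<lambda>n. 2 * ?e s n + 2 * ?e t n) \<longlonglongrightarrow> 0"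
      by simp
    have "(\<lambda>n. ennreal ((norm (?J (s n) - ?J (t n)))\<^sup>2)) \<longlonglongrightarrow> 0"
    proof (rule tendsto_sandwich[OF _ _ tendsto_const lim])
      show "\<forall>\<^sub>F n in sequentially. ennreal ((norm (?J (s n) - ?J (t n)))\<^sup>2) \<le> 2 * ?e s n + 2 * ?e t n"
        by (intro always_eventually allI diff s t)
    qed simp
    then have "(\<lambda>n. (norm (?J (s n) - ?J (t n)))\<^sup>2) \<longlonglongrightarrow> 0"
      by (intro tendsto_ennrealD[where x = 0]) simp_all
    then have "(\<lambda>n. ?J (s n) - ?J (t n)) \<longlonglongrightarrow> 0"
      using tendsto_real_sqrt[of _ 0] by (force intro: tendsto_norm_zero_cancel)
    from tendsto_add[OF this g] show ?thesis
      by simp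
  qed
  have "opapp (spectral_integral M E h) f = g"
    unfolding spectral_integral_eq unbdd_op.sel
  proof (rule the_equality)
    \<comment> \<open>Uniqueness rests on the existence of \<open>t\<close>: with no approximating
      sequence at all, every vector would satisfy the description.\<close>
    show "g' = g" if "\<forall>s. L2_approx f h s \<longrightarrow> (\<lambda>n. ?J (s n)) \<longlonglongrightarrow> g'" for g'
      using that t g LIMSEQ_unique by blast
  qed (use lim in blast)
  with lim[OF s] show ?thesis
    by simp
qed

text \<open>Simple functions approximating \<open>h\<close> at \<open>f\<close> also do so at
  \<open>E \<sigma> f\<close>, where the scalar measure is smaller. Commutation holds for their
  integrals and passes to the limit.\<close>

lemma spectral_integral_commutes:
  assumes h: "h \<in> borel_measurable M" and \<sigma>: "\<sigma> \<in> sets M"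
    and f: "f \<in> opdom (spectral_integral M E h)"
  shows "E \<sigma> f \<in> opdom (spectral_integral M E h)"
    "opapp (spectral_integral M E h) (E \<sigma> f) = E \<sigma> (opapp (spectral_integral M E h) f)"
proof -
  show dom: "E \<sigma> f \<in> opdom (spectral_integral M E h)"
    using f scalar_measure_projection_le[OF \<sigma>, of f "\<lambda>x. ennreal ((cmod (h x))\<^sup>2)"]
    by (auto simp: spectral_integral_def)
  obtain s where s: "L2_approx f h s"
    using L2_approx_exists[OF h f] .
  then have lim: "(\<lambda>n. \<integral>\<^sup>+ x. ennreal ((cmod (s n x - h x))\<^sup>2) \<partial>scalar_measure M E f) \<longlonglongrightarrow> 0"
    by (simp add: L2_approx_def)
  have "(\<lambda>n. \<integral>\<^sup>+ x. ennreal ((cmod (s n x - h x))\<^sup>2) \<partial>scalar_measure M E (E \<sigma> f)) \<longlonglongrightarrow> 0"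
    by (rule tendsto_sandwich[OF _ _ tendsto_const lim])
      (simp_all add: scalar_measure_projection_le[OF \<sigma>])
  then have "L2_approx (E \<sigma> f) h s"
    using s by (simp add: L2_approx_def)
  from spectral_integral_LIMSEQ[OF h dom this]
  have "(\<lambda>n. E \<sigma> (simple_spectral_integral M E (s n) f)) \<longlonglongrightarrow> opapp (spectral_integral M E h) (E \<sigma> f)"
    using s by (simp add: L2_approx_def simple_spectral_integral_projection[OF _ \<sigma>])
  moreover have "(\<lambda>n. E \<sigma> (simple_spectral_integral M E (s n) f)) \<longlonglongrightarrow> E \<sigma> (opapp (spectral_integral M E h) f)"
    by (rule tendsto_orthogonal_projection[OF spectral_measure_projection[OF \<sigma>]
        spectral_integral_LIMSEQ[OF h f s]])
  ultimately show "opapp (spectral_integral M E h) (E \<sigma> f) = E \<sigma> (opapp (spectral_integral M E h) f)"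
    by (rule LIMSEQ_unique)
qed

end

section \<open>The equivalence\<close>

theorem theorem9p5:
  fixes \<phi> \<psi> :: "real \<Rightarrow> real"
    and A absA :: "'a::complex_hilbert unbdd_op"
    and E :: "real set \<Rightarrow> 'a \<Rightarrow> 'a"
  assumes \<phi>_borel: "\<phi> \<in> measurable borel_Rplus borel_Rplus"
    and \<psi>_borel: "\<psi> \<in> measurable borel_Rplus borel_Rplus"
    and A_linear: "linear_op A"
    and A_closed: "closed_op A"
    and A_dense: "densely_defined A"
    and absA_modulus: "is_modulus A absA"
    and E_spectral: "is_spectral_measure_of E absA"
  shows "(\<forall>\<sigma>\<in>sets borel_Rplus.
            everywhere_defined (E (\<psi> -` \<sigma> \<inter> {0..})) \<circ>\<^sub>o A
              \<subseteq>\<^sub>o A \<circ>\<^sub>o everywhere_defined (E (\<phi> -` \<sigma> \<inter> {0..})))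
     \<longleftrightarrow>
         (\<forall>f\<in>opdom A. \<forall>\<sigma>\<in>sets borel_Rplus.
            cinner (E (\<phi> -` \<sigma> \<inter> {0..}) (opapp absA f)) (opapp absA f)
              \<le> cinner (E (\<psi> -` \<sigma> \<inter> {0..}) (opapp A f)) (opapp A f))"
    (is "?i \<longleftrightarrow> ?ii")
proof -
  define P where "P \<sigma> = E (\<phi> -` \<sigma> \<inter> {0..})" for \<sigma>
  define Q where "Q \<sigma> = E (\<psi> -` \<sigma> \<inter> {0..})" for \<sigma>
  have E: "spectral_measure borel_Rplus E"
    and int: "absA \<approx>\<^sub>o spectral_integral borel_Rplus E complex_of_real"
    using E_spectral by (auto simp: is_spectral_measure_of_def)
  have space: "space borel_Rplus = {0..}"
    by (simp add: space_restrict_space)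
  have \<phi>: "\<phi> -` \<sigma> \<inter> {0..} \<in> sets borel_Rplus" and \<psi>: "\<psi> -` \<sigma> \<inter> {0..} \<in> sets borel_Rplus"
    if "\<sigma> \<in> sets borel_Rplus" for \<sigma>
    using measurable_sets[OF \<phi>_borel that] measurable_sets[OF \<psi>_borel that] unfolding space by auto
  have proj: "orthogonal_projection (P \<sigma>)" "orthogonal_projection (Q \<sigma>)"
    if "\<sigma> \<in> sets borel_Rplus" for \<sigma>
    unfolding P_def Q_def by (intro spectral_measure_projection[OF E] \<phi> \<psi> that)+
  have compl: "P ({0..} - \<sigma>) f = f - P \<sigma> f" "Q ({0..} - \<sigma>) f = f - Q \<sigma> f"
    if \<sigma>: "\<sigma> \<in> sets borel_Rplus" for \<sigma> f
  proof -
    \<comment> \<open>Both functions map the half-line into itself, so preimages respect complements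
      within it.\<close>
    have "\<phi> -` ({0..} - \<sigma>) \<inter> {0..} = {0..} - \<phi> -` \<sigma> \<inter> {0..}"
      "\<psi> -` ({0..} - \<sigma>) \<inter> {0..} = {0..} - \<psi> -` \<sigma> \<inter> {0..}"
      using measurable_space[OF \<phi>_borel] measurable_space[OF \<psi>_borel] unfolding space by auto
    then show "P ({0..} - \<sigma>) f = f - P \<sigma> f" "Q ({0..} - \<sigma>) f = f - Q \<sigma> f"
      using spectral_measure_Diff[OF E \<phi>[OF \<sigma>]] spectral_measure_Diff[OF E \<psi>[OF \<sigma>]]
      by (simp_all add: P_def Q_def space)
  qed
  have dom: "opdom absA = opdom A" and norm_eq: "\<And>f. f \<in> opdom A \<Longrightarrow> norm (opapp absA f) = norm (opapp A f)"
    using modulus_opdom_norm[OF A_linear A_closed A_dense absA_modulus] by auto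
  have P_dom: "P \<sigma> f \<in> opdom A" and P_comm: "opapp absA (P \<sigma> f) = P \<sigma> (opapp absA f)"
    if \<sigma>: "\<sigma> \<in> sets borel_Rplus" and f: "f \<in> opdom A" for \<sigma> f
  proof -
    have meas: "complex_of_real \<in> borel_measurable borel_Rplus"
      by (intro measurable_restrict_space1) simp
    \<comment> \<open>Through \<open>int\<close>, commutation with the integral of the identity
      function becomes commutation with \<open>absA\<close>.\<close>
    note c = spectral_integral_commutes[OF E meas \<phi>[OF \<sigma>], of f]
    show "P \<sigma> f \<in> opdom A" "opapp absA (P \<sigma> f) = P \<sigma> (opapp absA f)"
      using c f op_eqD[OF int] dom by (auto simp: P_def)
  qed
  have norm_P: "norm (P \<sigma> (opapp absA f)) = norm (opapp A (P \<sigma> f))"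
    if "\<sigma> \<in> sets borel_Rplus" "f \<in> opdom A" for \<sigma> f
    using norm_eq[OF P_dom[OF that]] P_comm[OF that] by simp
  \<comment> \<open>The left-hand product has domain \<open>opdom A\<close>, and
    \<open>P_dom\<close> puts this inside the domain of the right-hand one, so only equality of
    values remains.\<close>
  have i: "?i \<longleftrightarrow> (\<forall>\<sigma>\<in>sets borel_Rplus. \<forall>f\<in>opdom A. Q \<sigma> (opapp A f) = opapp A (P \<sigma> f))"
    using P_dom unfolding P_def Q_def op_le_def op_comp_def everywhere_defined_def by auto
  \<comment> \<open>Each form is the squared norm of a projected vector, hence real, so the order on
    complex numbers reduces to that on reals.\<close>
  have ii: "?ii \<longleftrightarrow> (\<forall>\<sigma>\<in>sets borel_Rplus. \<forall>f\<in>opdom A. (norm (P \<sigma> (opapp absA f)))\<^sup>2 \<le> (norm (Q \<sigma> (opapp A f)))\<^sup>2)"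
    using proj by (auto simp: cinner_orthogonal_projection less_eq_complex_def simp flip: P_def Q_def)
  show ?thesis
    unfolding i ii
  proof (intro iffI ballI)
    fix \<sigma> f assume "\<forall>\<sigma>\<in>sets borel_Rplus. \<forall>f\<in>opdom A. Q \<sigma> (opapp A f) = opapp A (P \<sigma> f)"
      "\<sigma> \<in> sets borel_Rplus" "f \<in> opdom A"
    then show "(norm (P \<sigma> (opapp absA f)))\<^sup>2 \<le> (norm (Q \<sigma> (opapp A f)))\<^sup>2"
      by (simp add: norm_P)
  next
    fix \<sigma> f
    assume le: "\<forall>\<sigma>\<in>sets borel_Rplus. \<forall>f\<in>opdom A. (norm (P \<sigma> (opapp absA f)))\<^sup>2 \<le> (norm (Q \<sigma> (opapp A f)))\<^sup>2"
      and \<sigma>: "\<sigma> \<in> sets borel_Rplus" and f: "f \<in> opdom A"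
    have \<sigma>': "{0..} - \<sigma> \<in> sets borel_Rplus"
      using sets.compl_sets[OF \<sigma>] unfolding space .
    have eq: "norm (Q \<sigma> (opapp A g)) = norm (P \<sigma> (opapp absA g))"
      and eq': "norm (opapp A g - Q \<sigma> (opapp A g)) = norm (opapp A (g - P \<sigma> g))" if g: "g \<in> opdom A" for g
    proof -
      have "(norm (P \<sigma> (opapp absA g)))\<^sup>2 \<le> (norm (Q \<sigma> (opapp A g)))\<^sup>2"
        "(norm (opapp absA g - P \<sigma> (opapp absA g)))\<^sup>2 \<le> (norm (opapp A g - Q \<sigma> (opapp A g)))\<^sup>2"
        using le[rule_format, OF \<sigma> g] le[rule_format, OF \<sigma>' g] by (simp_all add: compl[OF \<sigma>])
      then have "(norm (Q \<sigma> (opapp A g)))\<^sup>2 = (norm (P \<sigma> (opapp absA g)))\<^sup>2"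
        "(norm (opapp A g - Q \<sigma> (opapp A g)))\<^sup>2 = (norm (opapp absA g - P \<sigma> (opapp absA g)))\<^sup>2"
        using norm_orthogonal_projection_squared[OF proj(1)[OF \<sigma>], of "opapp absA g"]
          norm_orthogonal_projection_squared[OF proj(2)[OF \<sigma>], of "opapp A g"]
        unfolding norm_eq[OF g] by linarith+
      \<comment> \<open>Applied to the complement of \<open>\<sigma>\<close>, \<open>norm_P\<close>
        identifies the norm of \<open>opapp absA g - P \<sigma> (opapp absA g)\<close> with that of
        \<open>opapp A (g - P \<sigma> g)\<close>.\<close>
      then show "norm (Q \<sigma> (opapp A g)) = norm (P \<sigma> (opapp absA g))"
        "norm (opapp A g - Q \<sigma> (opapp A g)) = norm (opapp A (g - P \<sigma> g))"
        using norm_P[OF \<sigma>' g] by (simp_all add: compl[OF \<sigma>])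
    qed
    note PP = orthogonal_projectionD(3)[OF proj(1)[OF \<sigma>]] orthogonal_projection_diff[OF proj(1)[OF \<sigma>]]
    let ?g = "P \<sigma> f"
    have g: "?g \<in> opdom A" and fg: "f - ?g \<in> opdom A" "opapp A (f - ?g) = opapp A f - opapp A ?g"
      using P_dom[OF \<sigma> f] linear_op_diff[OF A_linear f] by auto
    \<comment> \<open>Since \<open>P \<sigma>\<close> fixes \<open>?g\<close>, the right side of
      \<open>eq'\<close> at \<open>?g\<close> is the norm of \<open>opapp A 0\<close>.\<close>
    have "Q \<sigma> (opapp A ?g) = opapp A ?g"
      using eq'[OF g] linear_op_zero[OF A_linear] by (simp add: PP)
    \<comment> \<open>Since \<open>P \<sigma>\<close> annihilates \<open>f - ?g\<close>,
      \<open>norm_P\<close> turns the right side of \<open>eq\<close> into the norm of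
      \<open>opapp A 0\<close>.\<close>
    moreover have "Q \<sigma> (opapp A (f - ?g)) = 0"
      using eq[OF fg(1)] norm_P[OF \<sigma> fg(1)] linear_op_zero[OF A_linear] by (simp add: PP)
    ultimately show "Q \<sigma> (opapp A f) = opapp A ?g"
      by (simp add: fg(2) orthogonal_projection_diff[OF proj(2)[OF \<sigma>]])
  qed
qed

end
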